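(* Let $p$ be a prime number and let $\eta,r\in\mathbb{N}$, $\eta,r\ge 1$, be such that $r\le\eta$ if $p$ is odd, and $r\le\min(2,\eta)$ if $p=2$. Let $H:=\mathbb{Z}_{p^\eta}$, with the trivial linear cycle set structure, and let $I:=\mathbb{Z}_{p^r}$. Let $a,b\in\mathbb{Z}_{p^r}$ satisfy $a^{p^\eta}=1$, $p^\eta b=0$ and $b^2=0$, and let $\beta$, $u$, $q$ be the integers attached to $(a,b)$ in the context. Then a complete family of representatives $(\alpha_\gamma,f_{\mathfrak{f}_0})$ of $2$-cocycles modulo coboundaries (with respect to the actions defined by $a$ and $b$) is parameterized by the pairs $$(\gamma,\mathfrak{f}_0)\in\bigl\{(p^{\,r-\min(u+1,\beta)}z_1,\;z_2)\in\mathbb{Z}_{p^r}\oplus\mathbb{Z}_{p^r}:\ 0\le z_1<p^{\min(u+1,\beta)}\ \text{ and }\ 0\le z_2<p^{q}\bigr\}.$$ That is, for each such $(\gamma,\mathfrak{f}_0)$ the pair $(\alpha_\gamma,f_{\mathfrak{f}_0})$ is a $2$-cocycle, and every $2$-cocycle is cohomologous to $(\alpha_\gamma,f_{\mathfrak{f}_0})$ for exactly one pair $(\gamma,\mathfrak{f}_0)$ in this set.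
   Context: $\mathbb{Z}_n$ denotes the ring of integers modulo $n$. An expression such as $0\le z<p^m$ for $z\in\mathbb{Z}_{p^r}$ means that $z$ is the class of an integer (also denoted $z$) in that range. Elements of $H=\mathbb{Z}_{p^\eta}$ are always represented by integers $0\le h<p^\eta$. A linear cycle set is an additive abelian group $L$ with a binary operation $\cdot$ such that all maps $m\mapsto l\cdot m$ are bijective, $l\cdot(m+n)=l\cdot m+l\cdot n$ and $(l+m)\cdot n=(l\cdot m)\cdot(l\cdot n)$ for all $l,m,n\in L$. It is trivial if $l\cdot m=m$ for all $l,m$. The groups $H$ and $I$ are considered as trivial linear cycle sets. Actions. Elements $a,b\in\mathbb{Z}_{p^r}$ with $a^{p^\eta}=1$, $p^\eta b=0$, $b^2=0$ correspond to the admissible pairs of actions $H\times I\to I$, $h\diamond y=a^hy$, and $I\times H\to I$, $y\prec h=b\,h\,y$. Cocycles. For maps $g,f\colon H\times H\to I$ let $I\times_{g,f}H$ be the set $I\times H$ with operations $(y,h)+(z,l)=(y+z+g(h,l),\,h+l)$ and $(y,h)\cdot(z,l)=(a^hz+f(h,l)+b\,a^h\,y\,l,\;l)$. The pair $(g,f)$ is called a $2$-cocycle if $I\times_{g,f}H$ is a linear cycle set and $I\to I\times_{g,f}H\to H$, $y\mapsto(y,0)$, $(y,h)\mapsto h$, is an extension of linear cycle sets (a short exact sequence of additive abelian groups whose maps are linear cycle set morphisms). Two $2$-cocycles $(g,f)$, $(g',f')$ are cohomologous (equal modulo coboundaries) if there is a map $\varphi\colon H\to I$ with $\varphi(0)=0$,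 $\varphi(h)-\varphi(h+l)+\varphi(l)=g(h,l)-g'(h,l)$ and $\varphi(l)+f(h,l)=a^h\varphi(l)+f'(h,l)+b\,l\,a^h\varphi(h)$ for all $h,l\in H$; equivalently, if the corresponding extensions are equivalent. For $\gamma,\mathfrak{f}_0\in\mathbb{Z}_{p^r}$ and integers $0\le h,h'<p^\eta$, put $\alpha_\gamma(h,h')=\gamma$ if $h+h'\ge p^\eta$ and $\alpha_\gamma(h,h')=0$ if $h+h'<p^\eta$, and $$f_{\mathfrak{f}_0}(h,h')=\sum_{j=0}^{h-1}h'a^{h-j-1}\mathfrak{f}_0+\sum_{j=1}^{h-1}j\,h'\,b\,a^j\,\mathfrak{f}_0 .$$ Integers attached to $(a,b)$. If $b\neq0$, write $b=p^\beta k'$ with $0\le\beta<r$ and $p\nmid k'$; if $b=0$, set $\beta:=r$. One has $a=1+pk$ for some $k$; if $a\neq1$, write $a-1=p^{u+1}s$ with $0\le u<r-1$ and $p\nmid s$; if $a=1$, set $u:=r-1$. Finally $q$ is the largest integer $\le r$ such that $p^q\mid ba+a-1$ in $\mathbb{Z}_{p^r}$. *)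

theory Defs
  imports
    "HOL-Algebra.Elementary_Groups"
    "HOL-Computational_Algebra.Primes"
    "HOL-Number_Theory.Cong"
begin

(* The additive group of a linear cycle set is the underlying monoid record of HOL-Algebra,
   so \<otimes> and \<one> are its sum and its zero; cdot is the cycle set operation. *)
record 'a lcs = "'a monoid" +
  cdot :: "'a \<Rightarrow> 'a \<Rightarrow> 'a"  (infixl \<open>\<cdot>\<index>\<close> 75)

locale linear_cycle_set = comm_group L
  for L :: "('a, 'm) lcs_scheme" (structure) +
  assumes cdot_bij:
      "l \<in> carrier L \<Longrightarrow> bij_betw (\<lambda>m. l \<cdot> m) (carrier L) (carrier L)"
    and cdot_sum_right:
      "\<lbrakk>l \<in> carrier L; m \<in> carrier L; n \<in> carrier L\<rbrakk>
        \<Longrightarrow> l \<cdot> (m \<otimes> n) = (l \<cdot> m) \<otimes> (l \<cdot> n)"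
    and cdot_sum_left:
      "\<lbrakk>l \<in> carrier L; m \<in> carrier L; n \<in> carrier L\<rbrakk>
        \<Longrightarrow> (l \<otimes> m) \<cdot> n = (l \<cdot> m) \<cdot> (l \<cdot> n)"

definition lcs_hom :: "('a, 'm) lcs_scheme \<Rightarrow> ('b, 'n) lcs_scheme \<Rightarrow> ('a \<Rightarrow> 'b) set" where
  "lcs_hom L M = {\<phi> \<in> hom L M.
     \<forall>l \<in> carrier L. \<forall>m \<in> carrier L. \<phi> (l \<cdot>\<^bsub>L\<^esub> m) = \<phi> l \<cdot>\<^bsub>M\<^esub> \<phi> m}"

definition lcs_extension ::
    "('i, 'k) lcs_scheme \<Rightarrow> ('b, 'm) lcs_scheme \<Rightarrow> ('h, 'n) lcs_scheme
      \<Rightarrow> ('i \<Rightarrow> 'b) \<Rightarrow> ('b \<Rightarrow> 'h) \<Rightarrow> bool" where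
  "lcs_extension I B H \<iota> \<pi> \<longleftrightarrow>
     linear_cycle_set I \<and> linear_cycle_set B \<and> linear_cycle_set H \<and>
     \<iota> \<in> lcs_hom I B \<and> \<pi> \<in> lcs_hom B H \<and>
     \<iota> \<in> mon I B \<and> \<pi> \<in> epi B H \<and> kernel B H \<pi> = \<iota> ` carrier I"

definition trivial_lcs :: "'a monoid \<Rightarrow> 'a lcs" where
  "trivial_lcs G = \<lparr>carrier = carrier G, monoid.mult = monoid.mult G, one = one G,
                    cdot = (\<lambda>l m. m)\<rparr>"

(* From here on, I = Z/p^r and H = Z/p^eta are represented by the integers in {0..<p^r} and
   {0..<p^eta}, as in integer_mod_group. *)

(* The set I x H with the operations determined by the actions (a, b) and by the maps g, f.
   The choice one = (0, 0) loses nothing: if y |-> (y, 0) is additive, then (0, 0) is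
   idempotent for the sum, hence is its neutral element. *)
definition twisted_prod ::
    "nat \<Rightarrow> nat \<Rightarrow> nat \<Rightarrow> int \<Rightarrow> int \<Rightarrow> (int \<Rightarrow> int \<Rightarrow> int) \<Rightarrow> (int \<Rightarrow> int \<Rightarrow> int)
      \<Rightarrow> (int \<times> int) lcs" where
  "twisted_prod p r \<eta> a b g f =
     \<lparr>carrier = {0..<int (p ^ r)} \<times> {0..<int (p ^ \<eta>)},
      monoid.mult = (\<lambda>(y, h) (z, l). ((y + z + g h l) mod int (p ^ r), (h + l) mod int (p ^ \<eta>))),
      one = (0, 0),
      cdot = (\<lambda>(y, h) (z, l).
        ((a ^ nat h * z + f h l + b * a ^ nat h * y * l) mod int (p ^ r), l))\<rparr>"

definition two_cocycle ::
    "nat \<Rightarrow> nat \<Rightarrow> nat \<Rightarrow> int \<Rightarrow> int \<Rightarrow> (int \<Rightarrow> int \<Rightarrow> int) \<Rightarrow> (int \<Rightarrow> int \<Rightarrow> int) \<Rightarrow> bool" where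
  "two_cocycle p r \<eta> a b g f \<longleftrightarrow>
     (\<forall>h \<in> {0..<int (p ^ \<eta>)}. \<forall>l \<in> {0..<int (p ^ \<eta>)}.
        g h l \<in> {0..<int (p ^ r)} \<and> f h l \<in> {0..<int (p ^ r)}) \<and>
     lcs_extension
       (trivial_lcs (integer_mod_group (p ^ r)))
       (twisted_prod p r \<eta> a b g f)
       (trivial_lcs (integer_mod_group (p ^ \<eta>)))
       (\<lambda>y. (y, 0)) (\<lambda>(y, h). h)"

definition cohomologous ::
    "nat \<Rightarrow> nat \<Rightarrow> nat \<Rightarrow> int \<Rightarrow> int \<Rightarrow> (int \<Rightarrow> int \<Rightarrow> int) \<Rightarrow> (int \<Rightarrow> int \<Rightarrow> int)
      \<Rightarrow> (int \<Rightarrow> int \<Rightarrow> int) \<Rightarrow> (int \<Rightarrow> int \<Rightarrow> int) \<Rightarrow> bool" where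
  "cohomologous p r \<eta> a b g f g' f' \<longleftrightarrow>
     (\<exists>\<phi> \<in> {0..<int (p ^ \<eta>)} \<rightarrow> {0..<int (p ^ r)}. \<phi> 0 = 0 \<and>
        (\<forall>h \<in> {0..<int (p ^ \<eta>)}. \<forall>l \<in> {0..<int (p ^ \<eta>)}.
           [\<phi> h - \<phi> ((h + l) mod int (p ^ \<eta>)) + \<phi> l = g h l - g' h l] (mod int (p ^ r)) \<and>
           [\<phi> l + f h l = a ^ nat h * \<phi> l + f' h l + b * l * a ^ nat h * \<phi> h] (mod int (p ^ r))))"

definition cocycle_alpha :: "nat \<Rightarrow> nat \<Rightarrow> int \<Rightarrow> int \<Rightarrow> int \<Rightarrow> int" where
  "cocycle_alpha p \<eta> \<gamma> h h' = (if h + h' \<ge> int (p ^ \<eta>) then \<gamma> else 0)"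

definition cocycle_f :: "nat \<Rightarrow> nat \<Rightarrow> int \<Rightarrow> int \<Rightarrow> int \<Rightarrow> int \<Rightarrow> int \<Rightarrow> int" where
  "cocycle_f p r a b f0 h h' =
     ((\<Sum>j<nat h. h' * a ^ (nat h - j - 1) * f0) +
      (\<Sum>j=1..<nat h. int j * h' * b * a ^ j * f0)) mod int (p ^ r)"

(* beta_of, u_of and q_of expect a, b \<in> {0..<p^r}, so that a = 1 and b = 0 mean
   equality in Z/p^r. *)
definition beta_of :: "nat \<Rightarrow> nat \<Rightarrow> int \<Rightarrow> nat" where
  "beta_of p r b = (if b = 0 then r else multiplicity (int p) b)"

(* For a \<noteq> 1, a - 1 = p^(u+1) s with p not dividing s; the truncated subtraction is harmless
   because p divides a - 1 when a^(p^eta) = 1. *)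
definition u_of :: "nat \<Rightarrow> nat \<Rightarrow> int \<Rightarrow> nat" where
  "u_of p r a = (if a = 1 then r - 1 else multiplicity (int p) (a - 1) - 1)"

definition q_of :: "nat \<Rightarrow> nat \<Rightarrow> int \<Rightarrow> int \<Rightarrow> nat" where
  "q_of p r a b = Max {q. q \<le> r \<and> int (p ^ q) dvd b * a + a - 1}"

end

(* Unfolding the axioms, (g, f) is a 2-cocycle iff g is a normalized symmetric 2-cocycle and f satisfies
   two identities linear in (g, f), and the coboundaries solve these identities. Subtracting the
   coboundary of h |-> -(g(1,0) + ... + g(1,h-1)) turns g into the carry cocycle alpha_gamma with
   gamma = g(1,0) + ... + g(1,p^eta-1). For g = alpha_gamma the identities say that f(h,l) is l f(h,1), that
   f(h,1) = f(1,1) F(h) with F(h) = sum_{j<h} a^j (1 + j b), and, looking at where a carry occurs, that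
   (a-1) gamma = 0 and b gamma = F(p^eta) f(1,1). Here F(p^eta) = 0 because p divides a-1 and b and r <= eta,
   so that f(1,1) is free. The coboundaries that preserve alpha_gamma come from the homomorphisms
   h |-> c h, and change f(1,1) by c (ba + a - 1), since F(h) (ba + a - 1) = a^h - 1 + b h a^h. *)

theory Submission
  imports Defs "HOL-Number_Theory.Residues"
begin

text \<open>Applied once per hypothesis, this leaves an identity of integers: the coefficients \<open>c\<close> express
  the goal as a linear combination of the hypotheses.\<close>

lemma cong_lincomb:
  assumes "[x = y] (mod m)" "[u - c * x = v - c * y] (mod m)"
  shows "[u = v] (mod (m::int))"
  using cong_add[OF cong_scalar_left[OF assms(1), of c] assms(2)] by simp

text \<open>For subtracting two instances of one linear identity; the equations for \<open>u\<close>
  and \<open>v\<close> absorb the regrouping of terms.\<close>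

lemma cong_diff_eq:
  assumes "[x = y] (mod m)" "[x' = y'] (mod m)" "u = x - x'" "v = y - y'"
  shows "[u = v] (mod (m::int))"
  using assms cong_diff by blast

section \<open>The twisted geometric sum \<open>F(h) = act_sum a b h\<close>\<close>

definition act_sum :: "int \<Rightarrow> int \<Rightarrow> nat \<Rightarrow> int" where
  "act_sum a b n = (\<Sum>j<n. a ^ j * (1 + int j * b))"

lemma act_sum_0 [simp]: "act_sum a b 0 = 0"
  and act_sum_Suc: "act_sum a b (Suc n) = act_sum a b n + a ^ n * (1 + int n * b)"
  by (simp_all add: act_sum_def)

lemma act_sum_1 [simp]: "act_sum a b (Suc 0) = 1"
  by (simp add: act_sum_Suc)

text \<open>When \<open>b * b\<close> vanishes, \<open>1 + j b\<close> is \<open>(1 + b)^j\<close>,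
  so \<open>act_sum a b n\<close> is the geometric sum of the powers of
  \<open>c = a (1 + b)\<close>. Splitting it after \<open>n\<close> terms gives
  \<open>F(m + n) = F(n) + c^n F(m)\<close>, with \<open>c^n\<close> expanded as
  \<open>a^n (1 + n b)\<close>.\<close>

lemma act_sum_add:
  assumes "[b * b = 0] (mod M)"
  shows "[act_sum a b (m + n)
           = act_sum a b n + a ^ n * act_sum a b m + b * int n * a ^ n * act_sum a b m] (mod M)"
proof (induction m)
  case 0
  then show ?case by simp
next
  case (Suc m)
  \<comment> \<open>The powers get names so that they count as indeterminates in a polynomial
    identity.\<close>
  obtain A B where AB: "a ^ m = A" "a ^ n = B" by blast
  show ?case
    using Suc assms unfolding cong_iff_dvd_diff add_Suc act_sum_Suc power_add of_nat_add AB
    by Groebner_Basis.algebra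
qed

text \<open>The geometric series \<open>F(n) (c - 1) = c^n - 1\<close> for
  \<open>c = b * a + a\<close>.\<close>

lemma act_sum_telescope:
  assumes "[b * b = 0] (mod M)"
  shows "[act_sum a b n * (b * a + a - 1) = a ^ n - 1 + b * int n * a ^ n] (mod M)"
proof (induction n)
  case 0
  then show ?case by simp
next
  case (Suc n)
  obtain A where A: "a ^ n = A" by blast
  show ?case
    using Suc assms unfolding cong_iff_dvd_diff act_sum_Suc power_Suc of_nat_Suc A
    by Groebner_Basis.algebra
qed

text \<open>Reversing the first sum turns the exponent \<open>h - j - 1\<close> into
  \<open>j\<close>; the second sum may start at \<open>j = 0\<close>, where its term is zero. Then
  the two merge termwise.\<close>

lemma cocycle_f_eq:
  "cocycle_f p r a b f0 h h' = (h' * act_sum a b (nat h) * f0) mod int (p ^ r)"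
proof -
  have "(\<Sum>j<nat h. h' * a ^ (nat h - j - 1) * f0) = (\<Sum>j<nat h. h' * a ^ j * f0)"
    using sum.nat_diff_reindex[of "\<lambda>j. h' * a ^ j * f0" "nat h"] by (simp add: diff_diff_add)
  moreover have "(\<Sum>j=1..<nat h. int j * h' * b * a ^ j * f0)
      = (\<Sum>j<nat h. int j * h' * b * a ^ j * f0)"
    by (intro sum.mono_neutral_left) auto
  ultimately show ?thesis
    unfolding cocycle_f_def act_sum_def sum_distrib_left sum_distrib_right
    by (simp add: sum.distrib[symmetric] algebra_simps)
qed

section \<open>Prime powers dividing sums of powers\<close>

lemma sum_block:
  fixes f :: "nat \<Rightarrow> 'a::comm_monoid_add"
  shows "(\<Sum>j<m * n. f j) = (\<Sum>i<m. \<Sum>j<n. f (j + i * n))"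
proof -
  have "(\<Sum>j\<in>{i * n..<i * n + n}. f j) = (\<Sum>j<n. f (j + i * n))" for i
    using sum.shift_bounds_nat_ivl[of f 0 "i * n" n] by (simp add: atLeast0LessThan add.commute)
  then show ?thesis by (simp flip: sum.nat_group)
qed

text \<open>Induction on \<open>n\<close>, writing an index below \<open>p^(n+1)\<close> as
  \<open>j + i p^n\<close>. Both sums acquire the factor \<open>\<Sum>i<p. a ^ (i * p ^ n)\<close>,
  a sum of \<open>p\<close> terms congruent to 1 and hence divisible by \<open>p\<close>; the second
  also acquires a multiple of \<open>p^n\<close>. The extra \<open>p\<close> in the second claim
  matters: for \<open>p = 2\<close> and \<open>n = 1\<close> that sum is \<open>a\<close>, which is
  odd.\<close>

lemma prime_power_dvd_sum_powers:
  assumes "int p dvd a - 1"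
  shows "int (p ^ n) dvd (\<Sum>j<p ^ n. a ^ j)"
    and "int (p ^ n) dvd int p * (\<Sum>j<p ^ n. int j * a ^ j)"
proof -
  have pow: "[a ^ k = 1] (mod int p)" for k
    using cong_pow[of a 1 "int p" k] assms by (simp add: cong_iff_dvd_diff)
  have p_dvd: "int p dvd (\<Sum>i<p. a ^ (i * m))" for m
  proof -
    have "[(\<Sum>i<p. a ^ (i * m)) = (\<Sum>i<p. 1)] (mod int p)"
      by (intro cong_sum pow)
    then show ?thesis by (simp add: cong_dvd_iff)
  qed
  have S: "(\<Sum>j<p ^ Suc n. a ^ j) = (\<Sum>i<p. a ^ (i * p ^ n)) * (\<Sum>j<p ^ n. a ^ j)" for n
    unfolding power_Suc sum_block sum_product by (simp add: power_add mult.commute)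
  have T: "(\<Sum>j<p ^ Suc n. int j * a ^ j) = (\<Sum>i<p. a ^ (i * p ^ n)) * (\<Sum>j<p ^ n. int j * a ^ j)
             + int (p ^ n) * ((\<Sum>i<p. int i * a ^ (i * p ^ n)) * (\<Sum>j<p ^ n. a ^ j))" for n
    unfolding power_Suc sum_block sum_product
    by (simp add: power_add sum_product sum_distrib_left sum.distrib[symmetric] algebra_simps)
  show one: "int (p ^ n) dvd (\<Sum>j<p ^ n. a ^ j)" for n
  proof (induction n)
    case (Suc n)
    then show ?case unfolding S using p_dvd[of "p ^ n"] by (simp add: mult_dvd_mono)
  qed simp
  show "int (p ^ n) dvd int p * (\<Sum>j<p ^ n. int j * a ^ j)"
  proof (induction n)
    case (Suc n)
    have "int p * int (p ^ n) dvd (\<Sum>i<p. a ^ (i * p ^ n)) * (int p * (\<Sum>j<p ^ n. int j * a ^ j))"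
      using p_dvd Suc by (rule mult_dvd_mono)
    then show ?case
      unfolding T by (simp add: distrib_left mult.left_commute dvd_add)
  qed simp
qed

text \<open>The part of \<open>F\<close> that is weighted by \<open>j\<close> carries the
  coefficient \<open>b\<close>, whose factor \<open>p\<close> is the extra one demanded by the
  previous lemma.\<close>

lemma act_sum_prime_power:
  assumes "int p dvd a - 1" "int p dvd b"
  shows "[act_sum a b (p ^ n) = 0] (mod int (p ^ n))"
proof -
  obtain c where c: "b = int p * c" using assms(2) by blast
  have "act_sum a b (p ^ n)
      = (\<Sum>j<p ^ n. a ^ j) + c * (int p * (\<Sum>j<p ^ n. int j * a ^ j))"
    unfolding act_sum_def c by (simp add: sum_distrib_left sum.distrib[symmetric] algebra_simps)
  then show ?thesis
    using prime_power_dvd_sum_powers[OF assms(1), of n] by (simp add: cong_0_iff)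
qed

section \<open>The cocycle identities for Z/N acting on Z/M\<close>

text \<open>\<open>M\<close> and \<open>N\<close> stand for \<open>p ^ r\<close> and
  \<open>p ^ \<eta>\<close>. Elements of H are natural numbers below \<open>N\<close>, so that they
  can serve as exponents of \<open>a\<close>.\<close>

locale cyclic_action =
  fixes M :: int and N :: nat and a b :: int
  assumes M_pos: "M > 0" and N_gt_1: "N > 1" and M_dvd_N: "M dvd int N"
    and a_pow_N: "[a ^ N = 1] (mod M)" and b_square: "[b * b = 0] (mod M)"
    and act_sum_N: "[act_sum a b N = 0] (mod M)"
begin

text \<open>The conjuncts express, in this order, that \<open>(0, 0)\<close> is neutral, commutativity, associativity,
  and the axioms \<open>cdot_sum_right\<close> and \<open>cdot_sum_left\<close> on the elements \<open>(0, h)\<close>. The first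
  components of the remaining elements enter both sides of each axiom through the same linear terms.\<close>

definition cocycle_eqs :: "(nat \<Rightarrow> nat \<Rightarrow> int) \<Rightarrow> (nat \<Rightarrow> nat \<Rightarrow> int) \<Rightarrow> bool" where
  "cocycle_eqs g f \<longleftrightarrow> (\<forall>h<N. \<forall>l<N. \<forall>k<N.
     [g 0 h = 0] (mod M) \<and> [g h l = g l h] (mod M) \<and>
     [g h l + g ((h + l) mod N) k = g h ((l + k) mod N) + g l k] (mod M) \<and>
     [a ^ h * g l k + f h ((l + k) mod N) = f h l + f h k + g l k] (mod M) \<and>
     [f ((h + l) mod N) k + b * a ^ (h + l) * g h l * int k
        = a ^ l * f h k + f l k + b * a ^ l * int k * f h l] (mod M))"

text \<open>Two pairs are cohomologous when their difference is such a pair. Values are integers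
  taken modulo \<open>M\<close>, so neither \<phi> nor \<open>g\<close> and \<open>f\<close> have to
  be reduced.\<close>

definition is_coboundary ::
    "(nat \<Rightarrow> int) \<Rightarrow> (nat \<Rightarrow> nat \<Rightarrow> int) \<Rightarrow> (nat \<Rightarrow> nat \<Rightarrow> int) \<Rightarrow> bool" where
  "is_coboundary \<phi> g f \<longleftrightarrow> (\<forall>h<N. \<forall>l<N.
     [g h l = \<phi> h - \<phi> ((h + l) mod N) + \<phi> l] (mod M) \<and>
     [f h l = (a ^ h - 1) * \<phi> l + b * int l * a ^ h * \<phi> h] (mod M))"

abbreviation carry :: "int \<Rightarrow> nat \<Rightarrow> nat \<Rightarrow> int" where
  "carry \<gamma> h l \<equiv> (if h + l \<ge> N then \<gamma> else 0)"

lemma of_nat_mod_cong: "[int (h mod N) = int h] (mod M)"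
  by (metis M_dvd_N cong_def dvd_trans mod_mod_cancel of_nat_mod)

lemma pow_mod_cong: "[a ^ (h mod N) = a ^ h] (mod M)"
proof -
  have "[(a ^ N) ^ (h div N) * a ^ (h mod N) = 1 ^ (h div N) * a ^ (h mod N)] (mod M)"
    by (intro cong_mult cong_pow a_pow_N cong_refl)
  then show ?thesis by (simp add: power_mult[symmetric] power_add[symmetric] cong_sym)
qed

lemma cocycle_eqs_diff:
  assumes "cocycle_eqs g f" "cocycle_eqs g' f'"
  shows "cocycle_eqs (\<lambda>h l. g h l - g' h l) (\<lambda>h l. f h l - f' h l)"
  unfolding cocycle_eqs_def
proof (intro allI impI, goal_cases)
  case (1 h l k)
  note e = assms[unfolded cocycle_eqs_def, rule_format, OF 1]
  show ?case
    apply (intro conjI)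
    subgoal by (rule cong_diff_eq[OF e[THEN conjunct1]]) simp_all
    subgoal by (rule cong_diff_eq[OF e[THEN conjunct2, THEN conjunct1]]) simp_all
    subgoal by (rule cong_diff_eq[OF e[THEN conjunct2, THEN conjunct2, THEN conjunct1]]) simp_all
    subgoal by (rule cong_diff_eq[OF e[THEN conjunct2, THEN conjunct2, THEN conjunct2, THEN conjunct1]])
        (simp_all add: algebra_simps)
    subgoal by (rule cong_diff_eq[OF e[THEN conjunct2, THEN conjunct2, THEN conjunct2, THEN conjunct2]])
        (simp_all add: algebra_simps)
    done
qed

text \<open>By substitution all terms in \<phi> cancel. A coefficient \<open>(l + k) mod N\<close>
  becomes \<open>l + k\<close> because \<open>M\<close> divides \<open>N\<close>, exponents lose
  their \<open>mod N\<close> because \<open>a ^ N\<close> is 1, and the product of \<open>b\<close>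
  with the \<open>b\<close>-term of \<open>f h l\<close> vanishes with \<open>b * b\<close>.\<close>

lemma coboundary_cocycle_eqs:
  assumes cb: "is_coboundary \<phi> g f" and "[\<phi> 0 = 0] (mod M)"
  shows "cocycle_eqs g f"
  unfolding cocycle_eqs_def
proof (intro allI impI conjI)
  fix h l k assume hlk: "h < N" "l < N" "k < N"
  have G: "[g h l = \<phi> h - \<phi> ((h + l) mod N) + \<phi> l] (mod M)" if "h < N" "l < N" for h l
    using cb that by (simp add: is_coboundary_def)
  have F: "[f h l = (a ^ h - 1) * \<phi> l + b * int l * a ^ h * \<phi> h] (mod M)"
    if "h < N" "l < N" for h l
    using cb that by (simp add: is_coboundary_def)
  have N: "0 < N" "h mod N < N" for h using N_gt_1 by auto
  show "[g 0 h = 0] (mod M)"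
    using G[OF N(1) hlk(1)] assms(2) hlk unfolding cong_iff_dvd_diff by simp Groebner_Basis.algebra
  show "[g h l = g l h] (mod M)"
    using G[OF hlk(1,2)] G[OF hlk(2,1)] unfolding add.commute[of l h] cong_iff_dvd_diff by Groebner_Basis.algebra
  \<comment> \<open>Both nested sums reduce to the same value of \<phi> at
    \<open>(h + l + k) mod N\<close>, which then cancels.\<close>
  have "[g ((h + l) mod N) k = \<phi> ((h + l) mod N) - \<phi> ((h + l + k) mod N) + \<phi> k] (mod M)"
    "[g h ((l + k) mod N) = \<phi> h - \<phi> ((h + l + k) mod N) + \<phi> ((l + k) mod N)] (mod M)"
    using G[of "(h + l) mod N" k] G[of h "(l + k) mod N"] hlk N
    by (simp_all add: mod_simps add.assoc)
  with G[OF hlk(1,2)] G[OF hlk(2,3)]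
  show "[g h l + g ((h + l) mod N) k = g h ((l + k) mod N) + g l k] (mod M)"
    unfolding cong_iff_dvd_diff by Groebner_Basis.algebra
  show "[a ^ h * g l k + f h ((l + k) mod N) = f h l + f h k + g l k] (mod M)"
    by (rule cong_lincomb[OF G[OF hlk(2,3)], of _ "a ^ h - 1"],
        rule cong_lincomb[OF F[OF hlk(1) N(2), of "l + k"], of _ "1"],
        rule cong_lincomb[OF F[OF hlk(1,2)], of _ "-1"],
        rule cong_lincomb[OF F[OF hlk(1,3)], of _ "-1"],
        rule cong_lincomb[OF of_nat_mod_cong[of "l + k"], of _ "b * a ^ h * \<phi> h"],
        simp add: algebra_simps)
  show "[f ((h + l) mod N) k + b * a ^ (h + l) * g h l * int k
        = a ^ l * f h k + f l k + b * a ^ l * int k * f h l] (mod M)"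
    by (rule cong_lincomb[OF F[OF N(2)[of "h + l"] hlk(3)], of _ "1"],
        rule cong_lincomb[OF G[OF hlk(1,2)], of _ "b * a ^ (h + l) * int k"],
        rule cong_lincomb[OF F[OF hlk(1,3)], of _ "- (a ^ l)"],
        rule cong_lincomb[OF F[OF hlk(2,3)], of _ "-1"],
        rule cong_lincomb[OF F[OF hlk(1,2)], of _ "- (b * a ^ l * int k)"],
        rule cong_lincomb[OF pow_mod_cong[of "h + l"], of _ "\<phi> k + b * int k * \<phi> ((h + l) mod N)"],
        rule cong_lincomb[OF b_square, of _ "- (a ^ (h + l) * int k * int l * \<phi> h)"],
        simp add: algebra_simps power_add)
qed

lemma is_coboundary_diff:
  assumes "is_coboundary \<phi> g f" "is_coboundary \<psi> g' f'"
  shows "is_coboundary (\<lambda>h. \<phi> h - \<psi> h) (\<lambda>h l. g h l - g' h l) (\<lambda>h l. f h l - f' h l)"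
  unfolding is_coboundary_def
proof (intro allI impI conjI)
  fix h l assume hl: "h < N" "l < N"
  note e = assms[unfolded is_coboundary_def, rule_format, OF hl]
  show "[g h l - g' h l = \<phi> h - \<psi> h - (\<phi> ((h + l) mod N) - \<psi> ((h + l) mod N)) + (\<phi> l - \<psi> l)] (mod M)"
    by (rule cong_diff_eq[OF e[THEN conjunct1]]) simp_all
  show "[f h l - f' h l = (a ^ h - 1) * (\<phi> l - \<psi> l) + b * int l * a ^ h * (\<phi> h - \<psi> h)] (mod M)"
    by (rule cong_diff_eq[OF e[THEN conjunct2]]) (simp_all add: algebra_simps)
qed

lemma is_coboundary_cong:
  assumes "is_coboundary \<phi> g f"
    "\<And>h l. h < N \<Longrightarrow> l < N \<Longrightarrow> [g' h l = g h l] (mod M)"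
    "\<And>h l. h < N \<Longrightarrow> l < N \<Longrightarrow> [f' h l = f h l] (mod M)"
  shows "is_coboundary \<phi> g' f'"
  unfolding is_coboundary_def
proof (intro allI impI conjI)
  fix h l assume hl: "h < N" "l < N"
  then show "[g' h l = \<phi> h - \<phi> ((h + l) mod N) + \<phi> l] (mod M)"
    using assms(1) unfolding is_coboundary_def by (blast intro: cong_trans[OF assms(2)])
  from hl show "[f' h l = (a ^ h - 1) * \<phi> l + b * int l * a ^ h * \<phi> h] (mod M)"
    using assms(1) unfolding is_coboundary_def by (blast intro: cong_trans[OF assms(3)])
qed

text \<open>As \<open>M\<close> divides \<open>N\<close>, \<open>h \<mapsto> c h\<close> is a
  homomorphism from H to I, so its first component is zero; the geometric series puts the second
  into the shape \<open>l F(h) d\<close>.\<close>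

lemma is_coboundary_hom:
  "is_coboundary (\<lambda>h. c * int h) (\<lambda>h l. 0)
     (\<lambda>h l. int l * act_sum a b h * (c * (b * a + a - 1)))"
  unfolding is_coboundary_def
proof (intro allI impI conjI)
  fix h l
  obtain A where A: "a ^ h = A" by blast
  show "[0 = c * int h - c * int ((h + l) mod N) + c * int l] (mod M)"
    using of_nat_mod_cong[of "h + l"] unfolding cong_iff_dvd_diff of_nat_add by Groebner_Basis.algebra
  show "[int l * act_sum a b h * (c * (b * a + a - 1))
      = (a ^ h - 1) * (c * int l) + b * int l * a ^ h * (c * int h)] (mod M)"
    using act_sum_telescope[OF b_square, of a h] unfolding cong_iff_dvd_diff A by Groebner_Basis.algebra
qed

text \<open>Since \<open>a\<close> fixes \<gamma> and \<open>b\<close> kills it, the carries drop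
  out of the two identities for \<open>f\<close>. What remains is additivity in the second argument
  and the splitting rule of \<open>F\<close>.\<close>

lemma carry_cocycle_eqs:
  assumes a\<gamma>: "[(a - 1) * \<gamma> = 0] (mod M)" and b\<gamma>: "[b * \<gamma> = 0] (mod M)"
  shows "cocycle_eqs (carry \<gamma>) (\<lambda>h l. int l * act_sum a b h * c)"
  unfolding cocycle_eqs_def
proof (intro allI impI conjI)
  fix h l k assume hlk: "h < N" "l < N" "k < N"
  have a\<gamma>': "[(a - 1) * carry \<gamma> l k = 0] (mod M)" and b\<gamma>': "[b * carry \<gamma> l k = 0] (mod M)"
    for l k using a\<gamma> b\<gamma> by simp_all
  have pow\<gamma>: "[a ^ n * carry \<gamma> l k = carry \<gamma> l k] (mod M)" for n l k
  proof (induction n)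
    case (Suc n)
    show ?case
      by (rule cong_lincomb[OF Suc, of _ a], rule cong_lincomb[OF a\<gamma>'[of l k], of _ 1],
          simp add: algebra_simps)
  qed simp
  have mod_N: "(x + y) mod N = (if x + y < N then x + y else x + y - N)" if "x < N" "y < N" for x y
    using that by (auto simp: mod_if)
  show "[carry \<gamma> 0 h = 0] (mod M)" "[carry \<gamma> h l = carry \<gamma> l h] (mod M)"
    using hlk by (auto simp: add.commute)
  show "[carry \<gamma> h l + carry \<gamma> ((h + l) mod N) k = carry \<gamma> h ((l + k) mod N) + carry \<gamma> l k] (mod M)"
    using hlk by (auto simp: mod_N)
  show "[a ^ h * carry \<gamma> l k + int ((l + k) mod N) * act_sum a b h * c
      = int l * act_sum a b h * c + int k * act_sum a b h * c + carry \<gamma> l k] (mod M)"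
    by (rule cong_lincomb[OF pow\<gamma>[of h l k], of _ "1"],
        rule cong_lincomb[OF of_nat_mod_cong[of "l + k"], of _ "act_sum a b h * c"],
        simp add: algebra_simps del: of_nat_mod)
  \<comment> \<open>\<open>F\<close> is periodic modulo \<open>N\<close>: splitting off
    \<open>N\<close> terms leaves \<open>F(N) = 0\<close>, \<open>a ^ N = 1\<close> and a multiple
    of \<open>N\<close>, which is 0 modulo \<open>M\<close>.\<close>
  have S: "[act_sum a b ((h + l) mod N) = act_sum a b (h + l)] (mod M)"
  proof (cases "h + l < N")
    case False
    have "[int N = 0] (mod M)" using M_dvd_N by (simp add: cong_0_iff)
    have "[act_sum a b (h + l - N + N) = act_sum a b (h + l - N)] (mod M)"
      by (rule cong_lincomb[OF act_sum_add[OF b_square, of a "h + l - N" N], of _ "1"],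
          rule cong_lincomb[OF act_sum_N, of _ "1"],
          rule cong_lincomb[OF a_pow_N, of _ "act_sum a b (h + l - N)"],
          rule cong_lincomb[OF \<open>[int N = 0] (mod M)\<close>, of _ "b * a ^ N * act_sum a b (h + l - N)"],
          simp add: algebra_simps del: of_nat_diff)
    with False hlk show ?thesis by (simp add: mod_N cong_sym)
  qed simp
  show "[int k * act_sum a b ((h + l) mod N) * c + b * a ^ (h + l) * carry \<gamma> h l * int k
     = a ^ l * (int k * act_sum a b h * c) + int k * act_sum a b l * c
       + b * a ^ l * int k * (int l * act_sum a b h * c)] (mod M)"
    by (rule cong_lincomb[OF S, of _ "int k * c"],
        rule cong_lincomb[OF act_sum_add[OF b_square, of a h l], of _ "int k * c"],
        rule cong_lincomb[OF b\<gamma>'[of h l], of _ "a ^ (h + l) * int k"],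
        simp add: algebra_simps power_add)
qed

lemma carry_normal_form:
  assumes "cocycle_eqs (carry \<gamma>) f"
  shows "[(a - 1) * \<gamma> = 0] (mod M)" and "[b * \<gamma> = 0] (mod M)"
    and "h < N \<Longrightarrow> l < N \<Longrightarrow> [f h l = int l * act_sum a b h * f 1 1] (mod M)"
proof -
  have N: "0 < N" "1 < N" "N - 1 < N" "1 + (N - 1) = N" using N_gt_1 by auto
  have A: "[a ^ h * carry \<gamma> l k + f h ((l + k) mod N) = f h l + f h k + carry \<gamma> l k] (mod M)"
    and B: "[f ((h + l) mod N) k + b * a ^ (h + l) * carry \<gamma> h l * int k
        = a ^ l * f h k + f l k + b * a ^ l * int k * f h l] (mod M)"
    if "h < N" "l < N" "k < N" for h l k
    using assms that unfolding cocycle_eqs_def by blast+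
  \<comment> \<open>The identity \<open>A\<close> at \<open>l = k = 0\<close>, where no carry
    occurs.\<close>
  have f0: "[f h 0 = 0] (mod M)" if "h < N" for h
    using A[OF that N(1) N(1)] N(1) by (simp add: cong_iff_dvd_diff dvd_minus_iff)
  \<comment> \<open>Below \<open>N\<close> the sum \<open>1 + l\<close> has no carry, so
    \<open>A\<close> makes \<open>f h\<close> additive there.\<close>
  have lin: "[f h l = int l * f h 1] (mod M)" if "h < N" "l < N" for h l
    using that(2)
  proof (induction l)
    case 0
    then show ?case using f0[OF that(1)] by simp
  next
    case (Suc l)
    then show ?case
      using A[OF that(1) N(2), of l] unfolding cong_iff_dvd_diff
      by (simp add: algebra_simps) Groebner_Basis.algebra
  qed
  have f01: "[f 0 1 = 0] (mod M)"
    using B[OF N(1) N(1) N(2)] f0[OF N(1)] N unfolding cong_iff_dvd_diff by simp Groebner_Basis.algebra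
  have f1: "[f h 1 = act_sum a b h * f 1 1] (mod M)" if "h < N" for h
    using that
  proof (induction h)
    case 0
    then show ?case using f01 by simp
  next
    case (Suc h)
    \<comment> \<open>The identity \<open>B\<close> with first argument 1 adds one step to
      \<open>h\<close>, again without carry; it reproduces the recursion of
      \<open>act_sum\<close>.\<close>
    then have *: "[f (Suc h) 1 = a ^ h * f 1 1 + f h 1 + b * a ^ h * f 1 h] (mod M)"
      using B[OF N(2) _ N(2), of h] by simp
    have IH: "[f h 1 = act_sum a b h * f 1 1] (mod M)" and "h < N" using Suc by auto
    show ?case
      by (rule cong_lincomb[OF *, of _ "1"],
          rule cong_lincomb[OF IH, of _ "1"],
          rule cong_lincomb[OF lin[OF N(2) \<open>h < N\<close>], of _ "b * a ^ h"],
          simp add: act_sum_Suc algebra_simps)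
  qed
  \<comment> \<open>The sum \<open>1 + (N - 1)\<close> does carry. By linearity the values of
    \<open>f\<close> add up to \<open>N\<close> times \<open>f 1 1\<close>, that is 0, which
    isolates \<open>(a - 1) * \<gamma>\<close>.\<close>
  have e1: "[a * \<gamma> + f 1 0 = f 1 1 + f 1 (N - 1) + \<gamma>] (mod M)"
    using A[OF N(2) N(2) N(3)] N(4) by simp
  have e2: "[f 1 (N - 1) = (int N - 1) * f 1 1] (mod M)"
    using lin[OF N(2) N(3)] N by (simp add: of_nat_diff)
  have e3: "[int N = 0] (mod M)" using M_dvd_N by (simp add: cong_0_iff)
  show "[(a - 1) * \<gamma> = 0] (mod M)"
    by (rule cong_lincomb[OF e1, of _ "1"],
        rule cong_lincomb[OF e2, of _ "1"],
        rule cong_lincomb[OF f0[OF N(2)], of _ "-1"],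
        rule cong_lincomb[OF e3, of _ "f 1 1"],
        simp add: algebra_simps)
  \<comment> \<open>The same carry in \<open>B\<close>. With \<open>e5\<close> the right side
    becomes \<open>F(N)\<close> times \<open>f 1 1\<close>, which is 0, while the left side is
    \<open>b * \<gamma>\<close>.\<close>
  have e4: "[f 0 1 + b * a ^ N * \<gamma>
      = a ^ (N - 1) * f 1 1 + f (N - 1) 1 + b * a ^ (N - 1) * f 1 (N - 1)] (mod M)"
    using B[OF N(2) N(3) N(2)] N(4) by simp
  have e5: "act_sum a b N = act_sum a b (N - 1) + a ^ (N - 1) * (1 + (int N - 1) * b)"
    using act_sum_Suc[of a b "N - 1"] N by (simp add: of_nat_diff)
  show "[b * \<gamma> = 0] (mod M)"
    by (rule cong_lincomb[OF e4, of _ "1"],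
        rule cong_lincomb[OF f1[OF N(3)], of _ "1"],
        rule cong_lincomb[OF e2, of _ "b * a ^ (N - 1)"],
        rule cong_lincomb[OF act_sum_N, of _ "f 1 1"],
        rule cong_lincomb[OF f01, of _ "-1"],
        rule cong_lincomb[OF a_pow_N, of _ "- (b * \<gamma>)"],
        simp add: e5 algebra_simps)
  show "h < N \<Longrightarrow> l < N \<Longrightarrow> [f h l = int l * act_sum a b h * f 1 1] (mod M)"
    using lin[of h l] f1[of h] unfolding cong_iff_dvd_diff by Groebner_Basis.algebra
qed

lemma cohomologous_to_carry:
  assumes "cocycle_eqs g f"
  defines "\<phi> \<equiv> \<lambda>h. - (\<Sum>i<h. g 1 i)" and "\<gamma> \<equiv> \<Sum>i<N. g 1 i"
  shows "\<exists>f'. cocycle_eqs (carry \<gamma>) f' \<and>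
    is_coboundary \<phi> (\<lambda>h l. g h l - carry \<gamma> h l) (\<lambda>h l. f h l - f' h l)"
proof -
  have N: "0 < N" "1 < N" using N_gt_1 by auto
  have assoc: "[g h l + g ((h + l) mod N) k = g h ((l + k) mod N) + g l k] (mod M)"
    if "h < N" "l < N" "k < N" for h l k
    using assms(1) that unfolding cocycle_eqs_def by blast
  \<comment> \<open>\<open>G\<close> continues \<open>-\<phi>\<close> beyond \<open>N\<close> by
    reading indices modulo \<open>N\<close>. Then \<open>g h l\<close> is
    \<open>G (h + l) - G h - G l\<close> in all cases, and the carry appears as the shift
    \<open>G (N + m) = G m + \<gamma>\<close>.\<close>
  define G where "G = (\<lambda>h. \<Sum>i<h. g 1 (i mod N))"
  have G_Suc: "G (Suc h) = G h + g 1 (h mod N)" for h by (simp add: G_def)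
  have G_eq: "G h = - \<phi> h" if "h \<le> N" for h
    using that unfolding G_def \<phi>_def by (auto intro!: sum.cong)
  have G_shift: "G (N + m) = G m + \<gamma>" for m
  proof (induction m)
    case 0
    show ?case using G_eq[of N] by (simp add: G_def \<phi>_def \<gamma>_def)
  qed (simp add: G_Suc)
  have g: "[g h l = G (h + l) - G h - G l] (mod M)" if "h < N" "l < N" for h l
    using that(1)
  proof (induction h)
    case 0
    then show ?case using assms(1) that N by (auto simp: cocycle_eqs_def G_def)
  next
    case (Suc h)
    \<comment> \<open>Associativity for \<open>1, h, l\<close> is the induction step.\<close>
    then have *: "[g 1 h + g (Suc h) l = g 1 ((h + l) mod N) + g h l] (mod M)"
      using assoc[of 1 h l] N that by simp
    have IH: "[g h l = G (h + l) - G h - G l] (mod M)" and "h < N" using Suc by auto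
    show ?case
      by (rule cong_lincomb[OF *, of _ 1], rule cong_lincomb[OF IH, of _ 1])
        (use \<open>h < N\<close> in \<open>simp add: G_Suc\<close>)
  qed
  define g' where "g' = (\<lambda>h l. \<phi> h - \<phi> ((h + l) mod N) + \<phi> l)"
  define f' where "f' = (\<lambda>h l. (a ^ h - 1) * \<phi> l + b * int l * a ^ h * \<phi> h)"
  have "is_coboundary \<phi> g' f'"
    unfolding is_coboundary_def g'_def f'_def by (intro allI impI conjI cong_refl)
  moreover have "[g h l - carry \<gamma> h l = g' h l] (mod M)" if "h < N" "l < N" for h l
  proof -
    have *: "g' h l = G (h + l) - G h - G l - carry \<gamma> h l"
    proof (cases "h + l < N")
      case True
      then show ?thesis using that G_eq[of h] G_eq[of l] G_eq[of "h + l"] by (simp add: g'_def)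
    next
      case False
      then have "(h + l) mod N = h + l - N" "N + (h + l - N) = h + l"
        using that by (auto simp: mod_if)
      then show ?thesis
        using False that G_eq[of h] G_eq[of l] G_eq[of "h + l - N"] G_shift[of "h + l - N"]
        by (simp add: g'_def)
    qed
    show ?thesis unfolding * by (rule cong_diff[OF g[OF that] cong_refl])
  qed
  ultimately have cb: "is_coboundary \<phi> (\<lambda>h l. g h l - carry \<gamma> h l) f'"
    by (rule is_coboundary_cong) (assumption | rule cong_refl)+
  \<comment> \<open>Removing the coboundary of \<phi> leaves the pair of
    \<open>carry \<gamma>\<close> and \<open>f - f'\<close>; this difference is the witness, the
    local \<open>f'\<close> being the coboundary part.\<close>
  have "cocycle_eqs (\<lambda>h l. g h l - (g h l - carry \<gamma> h l)) (\<lambda>h l. f h l - f' h l)"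
    by (rule cocycle_eqs_diff[OF assms(1) coboundary_cocycle_eqs[OF cb]]) (simp add: \<phi>_def)
  then have "cocycle_eqs (carry \<gamma>) (\<lambda>h l. f h l - f' h l)"
    by simp
  moreover have "is_coboundary \<phi> (\<lambda>h l. g h l - carry \<gamma> h l) (\<lambda>h l. f h l - (f h l - f' h l))"
    using cb by simp
  ultimately show ?thesis by blast
qed

text \<open>Where no carry occurs \<psi> is additive, so \<open>\<psi> h = h \<psi> 1\<close>. The
  carry at \<open>1 + (N - 1)\<close> then forces \<gamma> to be \<open>N \<psi> 1\<close>, which is
  0.\<close>

lemma carry_coboundary:
  assumes "is_coboundary \<psi> (carry \<gamma>) f" "[\<psi> 0 = 0] (mod M)"
  shows "[\<gamma> = 0] (mod M)" and "[f 1 1 = (b * a + a - 1) * \<psi> 1] (mod M)"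
proof -
  have N: "0 < N" "1 < N" "N - 1 < N" "1 + (N - 1) = N" using N_gt_1 by auto
  have g: "[carry \<gamma> h l = \<psi> h - \<psi> ((h + l) mod N) + \<psi> l] (mod M)" if "h < N" "l < N" for h l
    using assms(1) that by (simp add: is_coboundary_def)
  have lin: "[\<psi> h = int h * \<psi> 1] (mod M)" if "h < N" for h
    using that
  proof (induction h)
    case 0
    then show ?case using assms(2) by simp
  next
    case (Suc h)
    then have *: "[0 = \<psi> 1 - \<psi> (Suc h) + \<psi> h] (mod M)" and IH: "[\<psi> h = int h * \<psi> 1] (mod M)"
      using g[OF N(2), of h] by auto
    show ?case
      by (rule cong_lincomb[OF *, of _ "1"],
          rule cong_lincomb[OF IH, of _ "1"],
          simp add: algebra_simps)
  qed
  have e1: "[\<gamma> = \<psi> 1 - \<psi> 0 + \<psi> (N - 1)] (mod M)" using g[OF N(2,3)] N(4) by simp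
  have e2: "[\<psi> (N - 1) = (int N - 1) * \<psi> 1] (mod M)"
    using lin[OF N(3)] N by (simp add: of_nat_diff)
  have e3: "[int N = 0] (mod M)" using M_dvd_N by (simp add: cong_0_iff)
  show "[\<gamma> = 0] (mod M)"
    by (rule cong_lincomb[OF e1, of _ "1"],
        rule cong_lincomb[OF e2, of _ "1"],
        rule cong_lincomb[OF assms(2), of _ "-1"],
        rule cong_lincomb[OF e3, of _ "\<psi> 1"],
        simp add: algebra_simps)
  have "[f 1 1 = (a - 1) * \<psi> 1 + b * 1 * a * \<psi> 1] (mod M)"
    using assms(1) N(2) unfolding is_coboundary_def by (metis of_nat_1 power_one_right)
  then show "[f 1 1 = (b * a + a - 1) * \<psi> 1] (mod M)"
    by (simp add: algebra_simps)
qed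

end

section \<open>Linear cycle sets and extensions in terms of the identities\<close>

lemma linear_cycle_set_trivial_lcs:
  assumes "comm_group G"
  shows "linear_cycle_set (trivial_lcs G)"
proof -
  interpret comm_group G by fact
  have "comm_group (trivial_lcs G)"
    by (rule comm_groupI) (auto simp: trivial_lcs_def m_assoc m_comm m_lcomm intro: l_inv_ex)
  then show ?thesis
    by (intro linear_cycle_set.intro linear_cycle_set_axioms.intro)
      (auto simp: trivial_lcs_def bij_betw_def)
qed

locale twisted_action = cyclic_action M N a b
  for M :: int and N :: nat and a b :: int and p r \<eta> :: nat +
  assumes M_eq: "M = int (p ^ r)" and N_eq: "N = p ^ \<eta>"
begin

lemma M_nz: "p ^ r \<noteq> 0"
  using M_pos M_eq by (metis of_nat_0 less_irrefl)

lemma N_nz: "p ^ \<eta> \<noteq> 0"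
  using N_gt_1 N_eq by linarith

abbreviation twisted where "twisted \<equiv> twisted_prod p r \<eta> a b"

lemma carrier_twisted [simp]: "carrier (twisted g f) = {0..<M} \<times> {0..<int N}"
  by (simp add: twisted_prod_def M_eq N_eq)

lemma one_twisted [simp]: "\<one>\<^bsub>twisted g f\<^esub> = (0, int 0)"
  by (simp add: twisted_prod_def)

lemma mult_twisted:
  "(y, int h) \<otimes>\<^bsub>twisted g f\<^esub> (z, int l)
     = ((y + z + g (int h) (int l)) mod M, int ((h + l) mod N))"
  by (simp add: twisted_prod_def M_eq N_eq zmod_int)

lemma cdot_twisted:
  "(y, int h) \<cdot>\<^bsub>twisted g f\<^esub> (z, int l)
     = ((a ^ h * z + f (int h) (int l) + b * a ^ h * y * int l) mod M, int l)"
  by (simp add: twisted_prod_def M_eq)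

text \<open>Writes the second component as \<open>int h\<close>, the form in which the identities
  over the naturals apply.\<close>

lemma twisted_cases:
  assumes "x \<in> carrier (twisted g f)"
  obtains y h where "x = (y, int h)" "y \<in> {0..<M}" "h < N"
proof -
  obtain y i where x: "x = (y, i)" "y \<in> {0..<M}" "i \<in> {0..<int N}"
    using assms by auto
  then show ?thesis using that[of y "nat i"] by (auto simp: nat_less_iff)
qed

lemma eqs_of_linear_cycle_set:
  assumes "linear_cycle_set (twisted g f)"
  shows "cocycle_eqs (\<lambda>h l. g (int h) (int l)) (\<lambda>h l. f (int h) (int l))"
  unfolding cocycle_eqs_def
proof (intro allI impI conjI)
  interpret T: linear_cycle_set "twisted g f" by fact
  fix h l k assume hlk: "h < N" "l < N" "k < N"
  have in_T: "(0, int n) \<in> carrier (twisted g f)" if "n < N" for n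
    using that M_pos by simp
  note T = in_T[OF hlk(1)] in_T[OF hlk(2)] in_T[OF hlk(3)]
  have "\<one>\<^bsub>twisted g f\<^esub> \<otimes>\<^bsub>twisted g f\<^esub> (0, int h) = (0, int h)"
    using T(1) by (rule T.l_one)
  then show "[g (int 0) (int h) = 0] (mod M)"
    unfolding one_twisted mult_twisted by (simp add: cong_def)
  show "[g (int h) (int l) = g (int l) (int h)] (mod M)"
    using T.m_comm[OF T(1,2)] unfolding mult_twisted by (simp add: cong_def)
  show "[g (int h) (int l) + g (int ((h + l) mod N)) (int k)
      = g (int h) (int ((l + k) mod N)) + g (int l) (int k)] (mod M)"
    using T.m_assoc[OF T] unfolding mult_twisted by (simp add: cong_def mod_simps add_ac)
  \<comment> \<open>The operations reduce their inner results; \<open>m_cong\<close> strips these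
    reductions one at a time.\<close>
  have m_cong: "[x mod M = x] (mod M)" for x by (simp add: cong_def)
  have c: "[a ^ h * (g (int l) (int k) mod M) + f (int h) (int ((l + k) mod N))
      = f (int h) (int l) mod M + f (int h) (int k) mod M + g (int l) (int k)] (mod M)"
    using T.cdot_sum_right[OF T] unfolding mult_twisted cdot_twisted
    by (simp add: cong_def)
  show "[a ^ h * g (int l) (int k) + f (int h) (int ((l + k) mod N))
      = f (int h) (int l) + f (int h) (int k) + g (int l) (int k)] (mod M)"
    by (rule cong_lincomb[OF c, of _ 1],
        rule cong_lincomb[OF m_cong[of "g (int l) (int k)"], of _ "- (a ^ h)"],
        rule cong_lincomb[OF m_cong[of "f (int h) (int l)"], of _ 1],
        rule cong_lincomb[OF m_cong[of "f (int h) (int k)"], of _ 1])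
      (simp add: algebra_simps)
  have d: "[f (int ((h + l) mod N)) (int k) + b * a ^ ((h + l) mod N) * (g (int h) (int l) mod M) * int k
      = a ^ l * (f (int h) (int k) mod M) + f (int l) (int k)
        + b * a ^ l * (f (int h) (int l) mod M) * int k] (mod M)"
    using T.cdot_sum_left[OF T] unfolding mult_twisted cdot_twisted
    by (simp add: cong_def)
  show "[f (int ((h + l) mod N)) (int k) + b * a ^ (h + l) * g (int h) (int l) * int k
      = a ^ l * f (int h) (int k) + f (int l) (int k) + b * a ^ l * int k * f (int h) (int l)] (mod M)"
    by (rule cong_lincomb[OF d, of _ 1],
        rule cong_lincomb[OF m_cong[of "g (int h) (int l)"], of _ "- (b * a ^ ((h + l) mod N) * int k)"],
        rule cong_lincomb[OF m_cong[of "f (int h) (int k)"], of _ "a ^ l"],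
        rule cong_lincomb[OF m_cong[of "f (int h) (int l)"], of _ "b * a ^ l * int k"],
        rule cong_lincomb[OF pow_mod_cong[of "h + l"], of _ "- (b * g (int h) (int l) * int k)"])
      (simp add: algebra_simps)
qed

lemma linear_cycle_set_twisted:
  assumes eqs: "cocycle_eqs (\<lambda>h l. g (int h) (int l)) (\<lambda>h l. f (int h) (int l))"
  shows "linear_cycle_set (twisted g f)"
proof -
  let ?T = "twisted g f"
  define G where "G = (\<lambda>h l. g (int h) (int l))"
  define F where "F = (\<lambda>h l. f (int h) (int l))"
  have N: "0 < N" "h mod N < N" for h using N_gt_1 by auto
  have m_in: "x mod M \<in> {0..<M}" for x using M_pos by simp
  have m_cong: "[x mod M = x] (mod M)" for x by (simp add: cong_def)
  have mult: "(y, int h) \<otimes>\<^bsub>?T\<^esub> (z, int l) = ((y + z + G h l) mod M, int ((h + l) mod N))" for y h z l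
    by (simp only: mult_twisted G_def)
  have cdot: "(y, int h) \<cdot>\<^bsub>?T\<^esub> (z, int l) = ((a ^ h * z + F h l + b * a ^ h * y * int l) mod M, int l)"
    for y h z l by (simp only: cdot_twisted F_def)
  have in_T: "(y, int h) \<in> carrier ?T \<longleftrightarrow> y \<in> {0..<M} \<and> h < N" for y h by simp
  have E: "[G 0 h = 0] (mod M)" "[G h l = G l h] (mod M)"
     "[G h l + G ((h + l) mod N) k = G h ((l + k) mod N) + G l k] (mod M)"
     "[a ^ h * G l k + F h ((l + k) mod N) = F h l + F h k + G l k] (mod M)"
     "[F ((h + l) mod N) k + b * a ^ (h + l) * G h l * int k
        = a ^ l * F h k + F l k + b * a ^ l * int k * F h l] (mod M)"
    if "h < N" "l < N" "k < N" for h l k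
    using eqs that unfolding cocycle_eqs_def G_def F_def by blast+
  have "comm_group ?T"
  proof (rule comm_groupI)
    fix x y assume "x \<in> carrier ?T" "y \<in> carrier ?T"
    then obtain x1 h y1 l where xy: "x = (x1, int h)" "h < N" "y = (y1, int l)" "l < N"
      by (metis twisted_cases)
    show "x \<otimes>\<^bsub>?T\<^esub> y \<in> carrier ?T"
      unfolding xy mult in_T using m_in N by blast
    have "[x1 + y1 + G h l = y1 + x1 + G l h] (mod M)"
      by (rule cong_lincomb[OF E(2)[OF xy(2,4) N(1)], of _ 1]) (simp add: add.commute)
    then show "x \<otimes>\<^bsub>?T\<^esub> y = y \<otimes>\<^bsub>?T\<^esub> x"
      unfolding xy mult by (simp add: cong_def add.commute[of h l])
  next
    fix x y z assume in_T': "x \<in> carrier ?T" "y \<in> carrier ?T" "z \<in> carrier ?T"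
    obtain x1 h where x: "x = (x1, int h)" "h < N" using in_T'(1) by (rule twisted_cases)
    obtain y1 l where y: "y = (y1, int l)" "l < N" using in_T'(2) by (rule twisted_cases)
    obtain z1 k where z: "z = (z1, int k)" "k < N" using in_T'(3) by (rule twisted_cases)
    note xyz = x y z
    have "[(x1 + y1 + G h l) mod M + z1 + G ((h + l) mod N) k
        = x1 + (y1 + z1 + G l k) mod M + G h ((l + k) mod N)] (mod M)"
      by (rule cong_lincomb[OF E(3)[OF xyz(2,4,6)], of _ 1],
          rule cong_lincomb[OF m_cong[of "x1 + y1 + G h l"], of _ 1],
          rule cong_lincomb[OF m_cong[of "y1 + z1 + G l k"], of _ "-1"]) (simp add: algebra_simps)
    then show "x \<otimes>\<^bsub>?T\<^esub> y \<otimes>\<^bsub>?T\<^esub> z = x \<otimes>\<^bsub>?T\<^esub> (y \<otimes>\<^bsub>?T\<^esub> z)"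
      unfolding xyz mult prod.inject cong_def by (simp only: mod_simps add.assoc)
  next
    show "\<one>\<^bsub>?T\<^esub> \<in> carrier ?T" using M_pos N by simp
  next
    fix x assume "x \<in> carrier ?T"
    then obtain x1 h where x: "x = (x1, int h)" "x1 \<in> {0..<M}" "h < N"
      by (metis twisted_cases)
    have "[0 + x1 + G 0 h = x1] (mod M)"
      by (rule cong_lincomb[OF E(1)[OF x(3) N(1) N(1)], of _ 1]) simp
    then show "\<one>\<^bsub>?T\<^esub> \<otimes>\<^bsub>?T\<^esub> x = x"
      unfolding x one_twisted mult using x(2,3) by (simp add: cong_def)
    \<comment> \<open>The first component cancels \<open>x1\<close> together with the value of
      \<open>G\<close> that the sum adds; the outer \<open>mod N\<close> covers
      \<open>h = 0\<close>, which is its own inverse.\<close>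
    have "((- x1 - G ((N - h) mod N) h) mod M, int ((N - h) mod N)) \<otimes>\<^bsub>?T\<^esub> x = \<one>\<^bsub>?T\<^esub>"
      unfolding x one_twisted mult using x(3) by (simp add: mod_simps add.assoc)
    then show "\<exists>y\<in>carrier ?T. y \<otimes>\<^bsub>?T\<^esub> x = \<one>\<^bsub>?T\<^esub>"
      using in_T m_in N(2) by blast
  qed
  moreover have "linear_cycle_set_axioms ?T"
  proof
    fix x assume "x \<in> carrier ?T"
    then obtain x1 h where x: "x = (x1, int h)" "x1 \<in> {0..<M}" "h < N"
      by (metis twisted_cases)
    \<comment> \<open>On a finite carrier mapped into itself injectivity suffices, and it holds
      because \<open>a ^ (N - h)\<close> inverts \<open>a ^ h\<close>.\<close>
    have "inj_on (\<lambda>m. x \<cdot>\<^bsub>?T\<^esub> m) (carrier ?T)"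
    proof (rule inj_onI)
      fix y z assume "y \<in> carrier ?T" "z \<in> carrier ?T" and eq: "x \<cdot>\<^bsub>?T\<^esub> y = x \<cdot>\<^bsub>?T\<^esub> z"
      then obtain y1 l z1 k where yz: "y = (y1, int l)" "y1 \<in> {0..<M}" "z = (z1, int k)" "z1 \<in> {0..<M}"
        by (metis twisted_cases)
      from eq have l: "l = k" and
        c: "[a ^ h * y1 + F h k + b * a ^ h * x1 * int k = a ^ h * z1 + F h k + b * a ^ h * x1 * int k] (mod M)"
        unfolding x yz cdot by (auto simp: cong_def)
      have "a ^ N = a ^ (N - h) * a ^ h" using x(3) by (simp flip: power_add)
      then have "[y1 = z1] (mod M)"
        by - (rule cong_lincomb[OF c, of _ "a ^ (N - h)"], rule cong_lincomb[OF a_pow_N, of _ "z1 - y1"],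
          simp add: algebra_simps)
      then show "y = z" using yz l by (simp add: cong_def)
    qed
    moreover have "(\<lambda>m. x \<cdot>\<^bsub>?T\<^esub> m) ` carrier ?T \<subseteq> carrier ?T"
    proof (rule image_subsetI)
      fix y assume "y \<in> carrier ?T"
      then obtain y1 l where y: "y = (y1, int l)" "l < N" by (metis twisted_cases)
      show "x \<cdot>\<^bsub>?T\<^esub> y \<in> carrier ?T"
        unfolding x y cdot in_T using m_in y(2) by blast
    qed
    moreover have "finite (carrier ?T)" by simp
    ultimately show "bij_betw (\<lambda>m. x \<cdot>\<^bsub>?T\<^esub> m) (carrier ?T) (carrier ?T)"
      unfolding bij_betw_def by (intro conjI endo_inj_surj)
  next
    fix x y z assume in_T': "x \<in> carrier ?T" "y \<in> carrier ?T" "z \<in> carrier ?T"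
    obtain x1 h where x: "x = (x1, int h)" "h < N" using in_T'(1) by (rule twisted_cases)
    obtain y1 l where y: "y = (y1, int l)" "l < N" using in_T'(2) by (rule twisted_cases)
    obtain z1 k where z: "z = (z1, int k)" "k < N" using in_T'(3) by (rule twisted_cases)
    note xyz = x y z
    \<comment> \<open>Naming the reduced entries makes each axiom a linear combination of the
      identity and the congruences for these names.\<close>
    obtain X Y Z K where X: "(y1 + z1 + G l k) mod M = X"
      "(a ^ h * y1 + F h l + b * a ^ h * x1 * int l) mod M = Y"
      "(a ^ h * z1 + F h k + b * a ^ h * x1 * int k) mod M = Z" "int ((l + k) mod N) = K" by blast
    have "[a ^ h * X + F h ((l + k) mod N) + b * a ^ h * x1 * K = Y + Z + G l k] (mod M)"
      by (rule cong_lincomb[OF E(4)[OF xyz(2,4,6)], of _ 1],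
          rule cong_lincomb[OF m_cong[of "y1 + z1 + G l k", unfolded X], of _ "a ^ h"],
          rule cong_lincomb[OF m_cong[of "a ^ h * y1 + F h l + b * a ^ h * x1 * int l", unfolded X], of _ "-1"],
          rule cong_lincomb[OF m_cong[of "a ^ h * z1 + F h k + b * a ^ h * x1 * int k", unfolded X], of _ "-1"],
          rule cong_lincomb[OF of_nat_mod_cong[of "l + k", unfolded X], of _ "b * a ^ h * x1"])
        (simp add: algebra_simps)
    then show "x \<cdot>\<^bsub>?T\<^esub> (y \<otimes>\<^bsub>?T\<^esub> z) = (x \<cdot>\<^bsub>?T\<^esub> y) \<otimes>\<^bsub>?T\<^esub> (x \<cdot>\<^bsub>?T\<^esub> z)"
      unfolding xyz mult cdot unfolding X cong_def by (simp only:)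
    \<comment> \<open>On the right the action by \<open>b\<close> is applied twice to
      \<open>x1\<close>, through \<open>Y\<close>; this is the term that \<open>b_square\<close>
      removes.\<close>
    obtain P V where V: "(x1 + y1 + G h l) mod M = V" "a ^ ((h + l) mod N) = P" by blast
    have "[P * z1 + F ((h + l) mod N) k + b * P * V * int k
      = a ^ l * Z + F l k + b * a ^ l * Y * int k] (mod M)"
      by (rule cong_lincomb[OF E(5)[OF xyz(2,4,6)], of _ 1],
          rule cong_lincomb[OF m_cong[of "x1 + y1 + G h l", unfolded V], of _ "b * P * int k"],
          rule cong_lincomb[OF m_cong[of "a ^ h * z1 + F h k + b * a ^ h * x1 * int k", unfolded X], of _ "- (a ^ l)"],
          rule cong_lincomb[OF m_cong[of "a ^ h * y1 + F h l + b * a ^ h * x1 * int l", unfolded X], of _ "- (b * a ^ l * int k)"],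
          rule cong_lincomb[OF pow_mod_cong[of "h + l", unfolded V], of _ "z1 + b * int k * (x1 + y1 + G h l)"],
          rule cong_lincomb[OF b_square, of _ "- (a ^ (h + l) * int k * int l * x1)"])
        (simp add: algebra_simps power_add)
    then show "(x \<otimes>\<^bsub>?T\<^esub> y) \<cdot>\<^bsub>?T\<^esub> z = (x \<cdot>\<^bsub>?T\<^esub> y) \<cdot>\<^bsub>?T\<^esub> (x \<cdot>\<^bsub>?T\<^esub> z)"
      unfolding xyz mult cdot unfolding V X(2,3) cong_def by (simp only:)
  qed
  ultimately show ?thesis by (rule linear_cycle_set.intro)
qed

lemma two_cocycle_iff:
  "two_cocycle p r \<eta> a b g f \<longleftrightarrow>
     (\<forall>h<N. \<forall>l<N. g (int h) (int l) \<in> {0..<M} \<and> f (int h) (int l) \<in> {0..<M}) \<and>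
     cocycle_eqs (\<lambda>h l. g (int h) (int l)) (\<lambda>h l. f (int h) (int l))"
proof -
  have "(\<forall>h \<in> {0..<int N}. \<forall>l \<in> {0..<int N}. P h l) \<longleftrightarrow> (\<forall>h<N. \<forall>l<N. P (int h) (int l))" for P
  proof (intro iffI ballI)
    fix h l assume "\<forall>h<N. \<forall>l<N. P (int h) (int l)" "h \<in> {0..<int N}" "l \<in> {0..<int N}"
    then show "P h l" using nat_less_iff by (metis atLeastLessThan_iff int_nat_eq)
  qed auto
  moreover have "lcs_extension (trivial_lcs (integer_mod_group (p ^ r))) (twisted g f)
       (trivial_lcs (integer_mod_group (p ^ \<eta>))) (\<lambda>y. (y, 0)) (\<lambda>(y, h). h) \<longleftrightarrow>
     cocycle_eqs (\<lambda>h l. g (int h) (int l)) (\<lambda>h l. f (int h) (int l))"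
    (is "lcs_extension ?I ?T ?H ?\<iota> ?\<pi> \<longleftrightarrow> ?E")
  proof
    assume "lcs_extension ?I ?T ?H ?\<iota> ?\<pi>"
    then show ?E by (auto simp: lcs_extension_def intro: eqs_of_linear_cycle_set)
  next
    assume E: ?E
    have car: "carrier ?I = {0..<M}" "carrier ?H = {0..<int N}"
      unfolding trivial_lcs_def M_eq N_eq
      by (simp_all only: partial_object.simps carrier_integer_mod_group M_nz N_nz if_False)
    have mul: "x \<otimes>\<^bsub>?I\<^esub> y = (x + y) mod M" "x \<otimes>\<^bsub>?H\<^esub> y = (x + y) mod int N"
      "x \<cdot>\<^bsub>?I\<^esub> y = y" "x \<cdot>\<^bsub>?H\<^esub> y = y" "\<one>\<^bsub>?H\<^esub> = 0" for x y
      by (simp_all add: trivial_lcs_def M_eq N_eq)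
    have N: "0 < N" using N_gt_1 by simp
    \<comment> \<open>The identities at 0 yield \<open>g 0 0 = 0\<close> and
      \<open>f 0 0 = 0\<close>, which is what makes \<open>y \<mapsto> (y, 0)\<close> a
      morphism.\<close>
    have g0: "[g 0 0 = 0] (mod M)" and gf0: "[a ^ 0 * g 0 0 + f 0 0 = f 0 0 + f 0 0 + g 0 0] (mod M)"
      using E N unfolding cocycle_eqs_def by (metis mod_0 add_0 of_nat_0)+
    then have f0: "[f 0 0 = 0] (mod M)"
      by (simp add: cong_iff_dvd_diff dvd_minus_iff)
    have T0: "(y, 0) \<otimes>\<^bsub>?T\<^esub> (z, 0) = ((y + z) mod M, 0)" "(y, 0) \<cdot>\<^bsub>?T\<^esub> (z, 0) = (z mod M, 0)" for y z
      using mult_twisted[of g f y 0 z 0] cdot_twisted[of g f y 0 z 0]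
        cong_add[OF cong_refl g0, of "y + z"] cong_add[OF cong_refl f0, of z]
      by (simp_all add: cong_def)
    have \<iota>: "?\<iota> \<in> hom ?I ?T"
      by (rule homI) (use N in \<open>auto simp: car mul T0\<close>)
    have \<pi>: "?\<pi> \<in> hom ?T ?H"
      by (rule homI) (auto simp: car mul twisted_prod_def N_eq)
    have "?\<pi> (x \<cdot>\<^bsub>?T\<^esub> y) = ?\<pi> y" for x y
      by (cases x; cases y) (simp add: twisted_prod_def)
    then have "?\<pi> \<in> lcs_hom ?T ?H"
      using \<pi> by (simp add: lcs_hom_def mul)
    moreover have "?\<iota> \<in> lcs_hom ?I ?T"
      using \<iota> by (simp add: lcs_hom_def mul car T0)
    moreover have "?\<iota> \<in> mon ?I ?T"
      using \<iota> by (simp add: mon_def inj_on_def)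
    moreover have "?\<pi> ` carrier ?T = carrier ?H"
      using M_pos by (force simp: car)
    then have "?\<pi> \<in> epi ?T ?H"
      using \<pi> by (simp add: epi_def)
    moreover have "kernel ?T ?H ?\<pi> = ?\<iota> ` carrier ?I"
      using N by (auto simp: kernel_def mul car)
    ultimately show "lcs_extension ?I ?T ?H ?\<iota> ?\<pi>"
      unfolding lcs_extension_def
      using linear_cycle_set_twisted[OF E] linear_cycle_set_trivial_lcs[OF abelian_integer_mod_group]
      by blast
  qed
  ultimately show ?thesis unfolding two_cocycle_def M_eq[symmetric] N_eq[symmetric] by simp
qed

lemma cohomologous_iff:
  "cohomologous p r \<eta> a b g f g' f' \<longleftrightarrow>
    (\<exists>\<phi>. \<phi> 0 = 0 \<and> is_coboundary \<phi> (\<lambda>h l. g (int h) (int l) - g' (int h) (int l))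
       (\<lambda>h l. f (int h) (int l) - f' (int h) (int l)))"
proof
  assume "cohomologous p r \<eta> a b g f g' f'"
  then obtain \<phi> where \<phi>: "\<phi> 0 = 0"
    "\<And>h l. h \<in> {0..<int N} \<Longrightarrow> l \<in> {0..<int N} \<Longrightarrow>
       [\<phi> h - \<phi> ((h + l) mod int N) + \<phi> l = g h l - g' h l] (mod M) \<and>
       [\<phi> l + f h l = a ^ nat h * \<phi> l + f' h l + b * l * a ^ nat h * \<phi> h] (mod M)"
    unfolding cohomologous_def M_eq N_eq by blast
  have "is_coboundary (\<lambda>h. \<phi> (int h)) (\<lambda>h l. g (int h) (int l) - g' (int h) (int l))
       (\<lambda>h l. f (int h) (int l) - f' (int h) (int l))"
    unfolding is_coboundary_def
  proof (intro allI impI conjI)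
    fix h l assume "h < N" "l < N"
    then have e: "[\<phi> (int h) - \<phi> ((int h + int l) mod int N) + \<phi> (int l)
         = g (int h) (int l) - g' (int h) (int l)] (mod M)"
      "[\<phi> (int l) + f (int h) (int l) = a ^ nat (int h) * \<phi> (int l) + f' (int h) (int l)
         + b * int l * a ^ nat (int h) * \<phi> (int h)] (mod M)"
      using \<phi>(2)[of "int h" "int l"] by auto
    show "[g (int h) (int l) - g' (int h) (int l)
        = \<phi> (int h) - \<phi> (int ((h + l) mod N)) + \<phi> (int l)] (mod M)"
      using e(1) by (simp add: cong_sym zmod_int)
    show "[f (int h) (int l) - f' (int h) (int l)
        = (a ^ h - 1) * \<phi> (int l) + b * int l * a ^ h * \<phi> (int h)] (mod M)"
      by (rule cong_lincomb[OF e(2), of _ 1]) (simp add: algebra_simps)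
  qed
  with \<phi>(1) show "\<exists>\<phi>. \<phi> 0 = 0 \<and> is_coboundary \<phi> (\<lambda>h l. g (int h) (int l) - g' (int h) (int l))
       (\<lambda>h l. f (int h) (int l) - f' (int h) (int l))"
    by (intro exI[of _ "\<lambda>h. \<phi> (int h)"]) simp
next
  assume "\<exists>\<phi>. \<phi> 0 = 0 \<and> is_coboundary \<phi> (\<lambda>h l. g (int h) (int l) - g' (int h) (int l))
       (\<lambda>h l. f (int h) (int l) - f' (int h) (int l))"
  then obtain \<phi> where \<phi>: "\<phi> 0 = 0" "is_coboundary \<phi> (\<lambda>h l. g (int h) (int l) - g' (int h) (int l))
       (\<lambda>h l. f (int h) (int l) - f' (int h) (int l))" by blast
  \<comment> \<open>Reduced, because a cohomology between pairs has to take values in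
    \<open>{0..<M}\<close>.\<close>
  let ?\<psi> = "\<lambda>i. \<phi> (nat i) mod M"
  have m_cong: "[x mod M = x] (mod M)" for x by (simp add: cong_def)
  show "cohomologous p r \<eta> a b g f g' f'"
    unfolding cohomologous_def M_eq[symmetric] N_eq[symmetric]
  proof (intro bexI[of _ ?\<psi>] conjI ballI)
    show "?\<psi> \<in> {0..<int N} \<rightarrow> {0..<M}" using M_pos by auto
    show "?\<psi> 0 = 0" using \<phi>(1) by simp
    fix i j assume "i \<in> {0..<int N}" "j \<in> {0..<int N}"
    then obtain h l where hl: "i = int h" "j = int l" "h < N" "l < N"
      by (metis atLeastLessThan_iff nonneg_int_cases of_nat_less_iff)
    have nat_mod: "nat ((int h + int l) mod int N) = (h + l) mod N"
      by (metis nat_int of_nat_add of_nat_mod)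
    have e: "[g (int h) (int l) - g' (int h) (int l) = \<phi> h - \<phi> ((h + l) mod N) + \<phi> l] (mod M)"
      "[f (int h) (int l) - f' (int h) (int l) = (a ^ h - 1) * \<phi> l + b * int l * a ^ h * \<phi> h] (mod M)"
      using \<phi>(2) hl(3,4) by (simp_all add: is_coboundary_def)
    show "[?\<psi> i - ?\<psi> ((i + j) mod int N) + ?\<psi> j = g i j - g' i j] (mod M)"
      unfolding hl nat_mod nat_int
      by (rule cong_lincomb[OF e(1), of _ "-1"], rule cong_lincomb[OF m_cong[of "\<phi> h"], of _ 1],
          rule cong_lincomb[OF m_cong[of "\<phi> l"], of _ 1],
          rule cong_lincomb[OF m_cong[of "\<phi> ((h + l) mod N)"], of _ "-1"]) simp
    show "[?\<psi> j + f i j = a ^ nat i * ?\<psi> j + f' i j + b * j * a ^ nat i * ?\<psi> i] (mod M)"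
      unfolding hl nat_int
      by (rule cong_lincomb[OF e(2), of _ 1], rule cong_lincomb[OF m_cong[of "\<phi> l"], of _ "1 - a ^ h"],
          rule cong_lincomb[OF m_cong[of "\<phi> h"], of _ "- (b * int l * a ^ h)"])
        (simp add: algebra_simps)
  qed
qed

section \<open>The representatives up to coboundaries\<close>

text \<open>\<open>cocycle_f\<close> before its reduction modulo \<open>M\<close>; \<open>c\<close>
  is the value at \<open>(1, 1)\<close>.\<close>

definition f_rep :: "int \<Rightarrow> nat \<Rightarrow> nat \<Rightarrow> int" where
  "f_rep c h l = int l * act_sum a b h * c"

lemma cocycle_alpha_int: "cocycle_alpha p \<eta> \<gamma> (int h) (int l) = carry \<gamma> h l"
  by (simp add: cocycle_alpha_def flip: N_eq)

lemma cocycle_f_int: "[cocycle_f p r a b c (int h) (int l) = f_rep c h l] (mod M)"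
  by (simp add: cocycle_f_eq f_rep_def cong_def M_eq)

lemma two_cocycle_rep:
  assumes "[(a - 1) * \<gamma> = 0] (mod M)" "[b * \<gamma> = 0] (mod M)" "\<gamma> \<in> {0..<M}"
  shows "two_cocycle p r \<eta> a b (cocycle_alpha p \<eta> \<gamma>) (cocycle_f p r a b c)"
proof -
  let ?f = "\<lambda>h l. cocycle_f p r a b c (int h) (int l)"
  \<comment> \<open>Reduction changes \<open>f_rep\<close> by multiples of \<open>M\<close> only, a
    coboundary of the zero map; so the identities pass from \<open>f_rep\<close> to
    \<open>cocycle_f\<close>.\<close>
  have "is_coboundary (\<lambda>_. 0) (\<lambda>_ _. 0) (\<lambda>h l. f_rep c h l - ?f h l)"
    unfolding is_coboundary_def
  proof (intro allI impI conjI)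
    fix h l
    show "[f_rep c h l - ?f h l = (a ^ h - 1) * 0 + b * int l * a ^ h * 0] (mod M)"
      using cong_diff[OF cong_refl cocycle_f_int[of c h l], of "f_rep c h l"] by simp
  qed simp
  then have "cocycle_eqs (\<lambda>_ _. 0) (\<lambda>h l. f_rep c h l - ?f h l)"
    by (rule coboundary_cocycle_eqs) simp
  from cocycle_eqs_diff[OF carry_cocycle_eqs[OF assms(1,2), of c] this]
  have "cocycle_eqs (carry \<gamma>) ?f"
    by (simp add: f_rep_def)
  moreover have "cocycle_f p r a b c h l \<in> {0..<M}" for h l
    unfolding cocycle_f_def M_eq[symmetric] using M_pos by simp
  ultimately show ?thesis
    unfolding two_cocycle_iff cocycle_alpha_int using assms(3) M_pos by simp
qed

lemma cohomologous_rep_iff: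
  "cohomologous p r \<eta> a b g f (cocycle_alpha p \<eta> \<gamma>) (cocycle_f p r a b c) \<longleftrightarrow>
    (\<exists>\<phi>. \<phi> 0 = 0 \<and> is_coboundary \<phi> (\<lambda>h l. g (int h) (int l) - carry \<gamma> h l)
       (\<lambda>h l. f (int h) (int l) - f_rep c h l))"
proof -
  have f: "[f (int h) (int l) - cocycle_f p r a b c (int h) (int l)
      = f (int h) (int l) - f_rep c h l] (mod M)" for h l
    by (intro cong_diff cong_refl cocycle_f_int)
  show ?thesis
    unfolding cohomologous_iff cocycle_alpha_int
    by (meson is_coboundary_cong cong_refl f cong_sym)
qed

text \<open>The quantified \<open>\<gamma>'\<close>, \<open>c'\<close> and \<open>d\<close> leave
  the choice of residues to the user of the lemma; \<open>d\<close> accounts for the homomorphism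
  \<open>h \<mapsto> d h\<close>.\<close>

lemma cohomologous_rep_exists:
  assumes "two_cocycle p r \<eta> a b g f"
  shows "\<exists>\<gamma> c. [(a - 1) * \<gamma> = 0] (mod M) \<and> [b * \<gamma> = 0] (mod M) \<and>
    (\<forall>\<gamma>' c' d. [\<gamma>' = \<gamma>] (mod M) \<longrightarrow> [c = c' + d * (b * a + a - 1)] (mod M) \<longrightarrow>
       cohomologous p r \<eta> a b g f (cocycle_alpha p \<eta> \<gamma>') (cocycle_f p r a b c'))"
proof -
  let ?g = "\<lambda>h l. g (int h) (int l)" and ?f = "\<lambda>h l. f (int h) (int l)"
  have eqs: "cocycle_eqs ?g ?f" using assms by (simp add: two_cocycle_iff)
  obtain \<phi> \<gamma> f' where \<phi>: "\<phi> 0 = 0" and f': "cocycle_eqs (carry \<gamma>) f'"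
    and cb: "is_coboundary \<phi> (\<lambda>h l. ?g h l - carry \<gamma> h l) (\<lambda>h l. ?f h l - f' h l)"
  proof -
    let ?\<phi> = "\<lambda>h. - (\<Sum>i<h. ?g 1 i)"
    have "?\<phi> 0 = 0" by simp
    then show thesis using cohomologous_to_carry[OF eqs] that[of ?\<phi>] by blast
  qed
  show ?thesis
  proof (rule exI[of _ \<gamma>], rule exI[of _ "f' 1 1"], intro conjI allI impI)
    show "[(a - 1) * \<gamma> = 0] (mod M)" "[b * \<gamma> = 0] (mod M)"
      by (rule carry_normal_form[OF f'])+
    fix \<gamma>' c' d assume \<gamma>': "[\<gamma>' = \<gamma>] (mod M)" and c': "[f' 1 1 = c' + d * (b * a + a - 1)] (mod M)"
    let ?\<psi> = "\<lambda>h. \<phi> h - (- d) * int h"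
    have "is_coboundary ?\<psi> (\<lambda>h l. ?g h l - carry \<gamma>' h l) (\<lambda>h l. ?f h l - f_rep c' h l)"
    proof (rule is_coboundary_cong[OF is_coboundary_diff[OF cb is_coboundary_hom[of "- d"]]])
      fix h l assume hl: "h < N" "l < N"
      have "[carry \<gamma>' h l = carry \<gamma> h l] (mod M)" using \<gamma>' by simp
      then show "[?g h l - carry \<gamma>' h l = ?g h l - carry \<gamma> h l - 0] (mod M)"
        unfolding diff_0_right by (intro cong_diff cong_refl)
      show "[?f h l - f_rep c' h l
          = ?f h l - f' h l - int l * act_sum a b h * (- d * (b * a + a - 1))] (mod M)"
        unfolding f_rep_def
        by (rule cong_lincomb[OF carry_normal_form(3)[OF f' hl], of _ 1],
            rule cong_lincomb[OF c', of _ "int l * act_sum a b h"])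
          (simp add: algebra_simps)
    qed
    moreover have "?\<psi> 0 = 0" using \<phi> by simp
    ultimately show "cohomologous p r \<eta> a b g f (cocycle_alpha p \<eta> \<gamma>') (cocycle_f p r a b c')"
      unfolding cohomologous_rep_iff by (intro exI[of _ ?\<psi>] conjI)
  qed
qed

lemma cohomologous_rep_unique:
  assumes "cohomologous p r \<eta> a b g f (cocycle_alpha p \<eta> \<gamma>) (cocycle_f p r a b c)"
    and "cohomologous p r \<eta> a b g f (cocycle_alpha p \<eta> \<gamma>') (cocycle_f p r a b c')"
  shows "[\<gamma> = \<gamma>'] (mod M)" and "\<exists>d. [c = c' + d * (b * a + a - 1)] (mod M)"
proof -
  obtain \<phi> \<phi>' where 0: "\<phi> 0 = 0" "\<phi>' 0 = 0"
    and cb: "is_coboundary \<phi> (\<lambda>h l. g (int h) (int l) - carry \<gamma> h l)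
       (\<lambda>h l. f (int h) (int l) - f_rep c h l)"
     "is_coboundary \<phi>' (\<lambda>h l. g (int h) (int l) - carry \<gamma>' h l)
       (\<lambda>h l. f (int h) (int l) - f_rep c' h l)"
    using assms unfolding cohomologous_rep_iff by blast
  \<comment> \<open>Subtracting the two cohomologies cancels \<open>g\<close> and \<open>f\<close>,
    and \<open>carry\<close> is additive in \<gamma>.\<close>
  have "is_coboundary (\<lambda>h. \<phi>' h - \<phi> h) (carry (\<gamma> - \<gamma>')) (\<lambda>h l. f_rep c h l - f_rep c' h l)"
    by (rule is_coboundary_cong[OF is_coboundary_diff[OF cb(2,1)]]) (simp_all add: cong_def)
  from carry_coboundary[OF this]
  have "[\<gamma> - \<gamma>' = 0] (mod M)"
    "[f_rep c 1 1 - f_rep c' 1 1 = (b * a + a - 1) * (\<phi>' 1 - \<phi> 1)] (mod M)"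
    using 0 by simp_all
  then show "[\<gamma> = \<gamma>'] (mod M)" "\<exists>d. [c = c' + d * (b * a + a - 1)] (mod M)"
    by (auto simp: cong_iff_dvd_diff f_rep_def algebra_simps intro!: exI[of _ "\<phi>' 1 - \<phi> 1"])
qed

end

section \<open>Valuations at p\<close>

text \<open>Write \<open>x = p^v s\<close> with \<open>s\<close> prime to \<open>p\<close>. The
  disjunction gives 0 the valuation \<open>r\<close>, the convention behind \<open>beta_of\<close>
  and, shifted by one, \<open>u_of\<close>.\<close>

lemma prime_power_dvd_mult_iff:
  fixes x y :: int
  assumes "prime p" "v \<le> r"
    and "(x = 0 \<and> v = r) \<or> (x \<noteq> 0 \<and> v = multiplicity (int p) x)"
  shows "int (p ^ r) dvd x * y \<longleftrightarrow> int (p ^ (r - v)) dvd y"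
proof (cases "x = 0")
  case False
  then have v: "v = multiplicity (int p) x" using assms(3) by blast
  have p: "prime (int p)" using assms(1) by simp
  obtain s where s: "x = int p ^ v * s" "\<not> int p dvd s"
    using multiplicity_decompose'[OF False, of "int p"] p not_prime_unit unfolding v by metis
  have "int (p ^ r) = int p ^ v * int (p ^ (r - v))"
    using assms(2) by (simp flip: power_add)
  moreover have "int p ^ v \<noteq> 0" using p by auto
  ultimately have "int (p ^ r) dvd x * y \<longleftrightarrow> int (p ^ (r - v)) dvd s * y"
    unfolding s(1) mult.assoc by (metis dvd_mult_cancel_left)
  moreover have "coprime (int (p ^ (r - v))) s"
    using p s(2) by (simp add: prime_imp_coprime)
  ultimately show ?thesis by (simp add: coprime_dvd_mult_right_iff)
qed (use assms in simp)

lemma multiplicity_less_of_less_power: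
  fixes x :: int
  assumes "prime p" "0 < x" "x < int (p ^ r)"
  shows "multiplicity (int p) x < r"
proof (rule multiplicity_lessI)
  show "x \<noteq> 0" "\<not> is_unit (int p)" using assms by auto
  show "\<not> int p ^ r dvd x" using assms zdvd_not_zless by force
qed

text \<open>By Fermat, raising to the power \<open>p\<close> is the identity modulo
  \<open>p\<close>, so \<open>a ^ (p ^ n)\<close> is congruent to \<open>a\<close>.\<close>

lemma cong_1_prime_of_pow_cong_1:
  fixes a :: int
  assumes "prime p" "[a ^ (p ^ n) = 1] (mod int p)"
  shows "[a = 1] (mod int p)"
proof -
  define c where "c = nat (a mod int p)"
  have p: "p > 0" using assms(1) prime_gt_0_nat by blast
  then have ac: "[a = int c] (mod int p)" by (simp add: c_def cong_def)
  have fermat: "[c ^ p = c] (mod p)"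
  proof (cases "p dvd c")
    case True
    then have "p dvd c ^ p" using p by (meson dvd_power dvd_trans)
    with True show ?thesis by (simp add: cong_def)
  next
    case False
    then have "[c * c ^ (p - 1) = c * 1] (mod p)"
      by (intro cong_mult cong_refl fermat_theorem assms(1))
    then show ?thesis using p by (simp flip: power_Suc)
  qed
  have "[c ^ (p ^ n) = c] (mod p)"
  proof (induction n)
    case (Suc n)
    have "[(c ^ p ^ n) ^ p = c ^ p] (mod p)" by (intro cong_pow Suc)
    then show ?case
      using fermat cong_trans by (simp add: mult.commute flip: power_mult) blast
  qed simp
  then have "[int c ^ (p ^ n) = int c] (mod int p)"
    by (metis cong_int_iff of_nat_power)
  then show ?thesis
    using assms(2) ac by (meson cong_pow cong_sym cong_trans)
qed

text \<open>For the last claim, \<open>gcd ?t (p^r)\<close> is some \<open>p^k\<close>, and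
  \<open>k \<le> q\<close> by maximality of \<open>q\<close>. Bezout makes \<open>p^k\<close>, hence
  its multiple \<open>p^q\<close>, a multiple of \<open>?t\<close> modulo
  \<open>p^r\<close>.\<close>

lemma q_of_props:
  assumes "prime p" and "q = q_of p r a b"
  shows "int (p ^ q) dvd b * a + a - 1" and "q \<le> r"
    and "\<exists>d. [int (p ^ q) = d * (b * a + a - 1)] (mod int (p ^ r))"
proof -
  let ?t = "b * a + a - 1" and ?Q = "{q. q \<le> r \<and> int (p ^ q) dvd b * a + a - 1}"
  have fin: "finite ?Q" by simp
  have "q \<in> ?Q" unfolding assms(2) q_of_def
    by (rule Max_in[OF fin]) (auto intro!: exI[of _ 0])
  then show q: "int (p ^ q) dvd ?t" "q \<le> r" by auto
  have "nat (gcd ?t (int (p ^ r))) dvd p ^ r"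
    by (metis gcd_dvd2 gcd_ge_0_int int_dvd_int_iff nat_0_le)
  then obtain k where k: "k \<le> r" "nat (gcd ?t (int (p ^ r))) = p ^ k"
    using divides_primepow_nat[OF assms(1)] by blast
  then have gcd: "gcd ?t (int (p ^ r)) = int (p ^ k)"
    by (metis gcd_ge_0_int int_nat_eq)
  then have "int (p ^ k) dvd ?t" by (metis gcd_dvd1)
  with k have "k \<le> q" unfolding assms(2) q_of_def by (intro Max_ge[OF fin]) simp
  then obtain e where e: "p ^ q = p ^ k * e" by (metis le_imp_power_dvd dvdE)
  obtain u v where uv: "u * ?t + v * int (p ^ r) = int (p ^ k)"
    using bezout_int[of ?t "int (p ^ r)"] gcd by auto
  have "int (p ^ q) - (int e * u) * ?t = int e * (int (p ^ k) - u * ?t)"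
    unfolding e by (simp add: algebra_simps)
  also have "\<dots> = int (p ^ r) * (int e * v)"
    unfolding uv[symmetric] by (simp add: mult_ac)
  finally show "\<exists>d. [int (p ^ q) = d * ?t] (mod int (p ^ r))"
    unfolding cong_iff_dvd_diff by (metis dvd_triv_left)
qed

section \<open>The parameter set and the classification\<close>

theorem theorem2p3:
  fixes p \<eta> r :: nat and a b :: int
  assumes "prime p" and "\<eta> \<ge> 1" and "r \<ge> 1"
    and "odd p \<Longrightarrow> r \<le> \<eta>"
    and "p = 2 \<Longrightarrow> r \<le> min 2 \<eta>"
    and "a \<in> {0..<int (p ^ r)}" and "b \<in> {0..<int (p ^ r)}"
    and "[a ^ (p ^ \<eta>) = 1] (mod int (p ^ r))"
    and "[int (p ^ \<eta>) * b = 0] (mod int (p ^ r))"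
    and "[b\<^sup>2 = 0] (mod int (p ^ r))"
  defines "\<beta> \<equiv> beta_of p r b" and "u \<equiv> u_of p r a" and "q \<equiv> q_of p r a b"
  defines "P \<equiv> {(int (p ^ (r - min (u + 1) \<beta>)) * z\<^sub>1, z\<^sub>2) | z\<^sub>1 z\<^sub>2.
                  0 \<le> z\<^sub>1 \<and> z\<^sub>1 < int (p ^ min (u + 1) \<beta>) \<and> 0 \<le> z\<^sub>2 \<and> z\<^sub>2 < int (p ^ q)}"
  shows "(\<forall>(\<gamma>, f0) \<in> P. two_cocycle p r \<eta> a b (cocycle_alpha p \<eta> \<gamma>) (cocycle_f p r a b f0)) \<and>
         (\<forall>g f. two_cocycle p r \<eta> a b g f \<longrightarrow>
            (\<exists>!(\<gamma>, f0). (\<gamma>, f0) \<in> P \<and>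
               cohomologous p r \<eta> a b g f (cocycle_alpha p \<eta> \<gamma>) (cocycle_f p r a b f0)))"
proof -
  let ?M = "int (p ^ r)" and ?t = "b * a + a - 1"
  have p: "p > 1" "prime (int p)" using assms(1) prime_gt_1_nat by auto
  have r_le: "r \<le> \<eta>"
    using assms(4,5) prime_odd_nat[OF assms(1)] p(1) by (cases "p = 2") auto
  have p_dvd_M: "int p dvd ?M" using assms(3) by (simp add: dvd_power)
  have "[a = 1] (mod int p)"
    by (rule cong_1_prime_of_pow_cong_1[OF assms(1) cong_dvd_modulus[OF assms(8) p_dvd_M]])
  then have pa: "int p dvd a - 1" by (simp add: cong_iff_dvd_diff)
  have "int p dvd b\<^sup>2" using assms(10) p_dvd_M by (metis cong_0_iff dvd_trans)
  then have pb: "int p dvd b" using p(2) prime_dvd_power by blast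
  have M_dvd_N: "?M dvd int (p ^ \<eta>)" using r_le by (simp add: le_imp_power_dvd)
  interpret twisted_action ?M "p ^ \<eta>" a b p r \<eta>
  proof
    show "?M > 0" "1 < p ^ \<eta>" using p(1) one_less_power[of p \<eta>] assms(2) by simp_all
    show "[b * b = 0] (mod ?M)" using assms(10) by (simp add: power2_eq_square)
    show "[act_sum a b (p ^ \<eta>) = 0] (mod ?M)"
      using act_sum_prime_power[OF pa pb] M_dvd_N cong_dvd_modulus by blast
  qed (use assms(8) M_dvd_N in simp_all)
  define m where "m = min (u + 1) \<beta>"
  have "(a - 1 = 0 \<and> u + 1 = r) \<or> (a - 1 \<noteq> 0 \<and> u + 1 = multiplicity (int p) (a - 1))"
    and u_le: "u + 1 \<le> r"
  proof -
    \<comment> \<open>Places \<open>a - 1\<close> in \<open>{0..<p^r}\<close>, so that its valuation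
      is below \<open>r\<close> when it is nonzero.\<close>
    have "a > 0"
    proof (rule ccontr)
      assume "\<not> a > 0"
      then have "int p dvd -1" using pa assms(6) by simp
      then show False using p by auto
    qed
    then have lt: "multiplicity (int p) (a - 1) < r" if "a \<noteq> 1"
      using multiplicity_less_of_less_power[OF assms(1), of "a - 1" r] assms(6) that by auto
    \<comment> \<open>This makes the truncated subtraction in \<open>u_of\<close> exact.\<close>
    have "multiplicity (int p) (a - 1) \<ge> 1" if "a \<noteq> 1"
      using multiplicity_geI[of "a - 1" "int p" 1] that pa p by auto
    then show "(a - 1 = 0 \<and> u + 1 = r) \<or> (a - 1 \<noteq> 0 \<and> u + 1 = multiplicity (int p) (a - 1))"
      using assms(3) by (cases "a = 1") (simp_all add: u_def u_of_def)
    then show "u + 1 \<le> r"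
      using lt by auto
  qed
  then have a\<gamma>: "[(a - 1) * \<gamma> = 0] (mod ?M) \<longleftrightarrow> int (p ^ (r - (u + 1))) dvd \<gamma>" for \<gamma>
    unfolding cong_0_iff by (intro prime_power_dvd_mult_iff assms(1) u_le)
  have \<beta>_le: "\<beta> \<le> r"
    using multiplicity_less_of_less_power[OF assms(1), of b r] assms(7)
    by (cases "b = 0") (auto simp: \<beta>_def beta_of_def)
  have "(b = 0 \<and> \<beta> = r) \<or> (b \<noteq> 0 \<and> \<beta> = multiplicity (int p) b)"
    unfolding \<beta>_def beta_of_def by simp
  then have b\<gamma>: "[b * \<gamma> = 0] (mod ?M) \<longleftrightarrow> int (p ^ (r - \<beta>)) dvd \<gamma>" for \<gamma>
    unfolding cong_0_iff by (intro prime_power_dvd_mult_iff assms(1) \<beta>_le)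
  \<comment> \<open>Of the two divisibility conditions on \<gamma> the stronger one belongs to the
    smaller of \<open>u + 1\<close> and \<beta>.\<close>
  have m_dvd: "int (p ^ (r - m)) dvd \<gamma> \<longleftrightarrow> [(a - 1) * \<gamma> = 0] (mod ?M) \<and> [b * \<gamma> = 0] (mod ?M)" for \<gamma>
  proof -
    have "p ^ (r - (u + 1)) dvd p ^ (r - m)" "p ^ (r - \<beta>) dvd p ^ (r - m)"
      by (intro le_imp_power_dvd; simp add: m_def)+
    moreover have "m = u + 1 \<or> m = \<beta>" by (auto simp: m_def)
    ultimately show ?thesis unfolding a\<gamma> b\<gamma> by (metis dvd_trans int_dvd_int_iff)
  qed
  have Mm: "?M = int (p ^ (r - m)) * int (p ^ m)"
    using u_le by (simp add: m_def flip: power_add)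
  \<comment> \<open>Multiplication by \<open>p^(r-m)\<close> identifies the range of
    \<open>z\<^sub>1\<close> with the multiples of \<open>p^(r-m)\<close> in
    \<open>{0..<p^r}\<close>.\<close>
  have P_iff: "(\<gamma>, c) \<in> P \<longleftrightarrow> \<gamma> \<in> {0..<?M} \<and> int (p ^ (r - m)) dvd \<gamma> \<and> c \<in> {0..<int (p ^ q)}" for \<gamma> c
  proof -
    have pos: "int (p ^ (r - m)) > 0" using p(1) by simp
    have z: "int (p ^ (r - m)) * z \<in> {0..<?M} \<longleftrightarrow> 0 \<le> z \<and> z < int (p ^ m)" for z
      unfolding Mm atLeastLessThan_iff using pos p(1) by (simp add: zero_le_mult_iff del: of_nat_power)
    have "(\<gamma>, c) \<in> P \<longleftrightarrow> (\<exists>z. \<gamma> = int (p ^ (r - m)) * z \<and>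
        int (p ^ (r - m)) * z \<in> {0..<?M}) \<and> c \<in> {0..<int (p ^ q)}"
      unfolding P_def m_def[symmetric] z by (simp only: mem_Collect_eq prod.inject atLeastLessThan_iff) blast
    then show ?thesis unfolding dvd_def by blast
  qed
  note q = q_of_props[OF assms(1) q_def[THEN meta_eq_to_obj_eq]]
  show ?thesis
  proof (intro conjI ballI allI impI)
    fix x assume "x \<in> P"
    then show "case x of (\<gamma>, f0) \<Rightarrow> two_cocycle p r \<eta> a b (cocycle_alpha p \<eta> \<gamma>) (cocycle_f p r a b f0)"
      using P_iff[of "fst x" "snd x"] m_dvd[of "fst x"] two_cocycle_rep[of "fst x" "snd x"]
      by (simp only: case_prod_beta prod.collapse simp_thms)
  next
    fix g f assume "two_cocycle p r \<eta> a b g f"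
    then obtain \<gamma> c where \<gamma>: "[(a - 1) * \<gamma> = 0] (mod ?M)" "[b * \<gamma> = 0] (mod ?M)"
      and rep: "\<And>\<gamma>' c' d. [\<gamma>' = \<gamma>] (mod ?M) \<Longrightarrow> [c = c' + d * ?t] (mod ?M) \<Longrightarrow>
       cohomologous p r \<eta> a b g f (cocycle_alpha p \<eta> \<gamma>') (cocycle_f p r a b c')"
      using cohomologous_rep_exists by blast
    define \<gamma>' where "\<gamma>' = \<gamma> mod ?M"
    define c' where "c' = c mod int (p ^ q)"
    have \<gamma>': "[\<gamma>' = \<gamma>] (mod ?M)" by (simp add: \<gamma>'_def cong_def)
    obtain d where d: "[int (p ^ q) = d * ?t] (mod ?M)" using q(3) by blast
    \<comment> \<open>\<open>c\<close> and its residue differ by a multiple of \<open>p^q\<close>,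
      which modulo \<open>p^r\<close> is a multiple of \<open>?t\<close>, hence absorbed by a
      homomorphism.\<close>
    have "[c = c' + (c div int (p ^ q) * d) * ?t] (mod ?M)"
      by (rule cong_lincomb[OF d, of _ "c div int (p ^ q)"])
        (simp add: c'_def algebra_simps minus_mult_div_eq_mod)
    with \<gamma>' have coh: "cohomologous p r \<eta> a b g f (cocycle_alpha p \<eta> \<gamma>') (cocycle_f p r a b c')"
      by (rule rep)
    have in_P: "(\<gamma>', c') \<in> P"
    proof -
      have "[x * \<gamma>' = 0] (mod ?M)" if "[x * \<gamma> = 0] (mod ?M)" for x
        using cong_trans[OF cong_scalar_left[OF \<gamma>'] that] .
      then show ?thesis
        unfolding P_iff m_dvd using \<gamma> p(1) by (simp add: \<gamma>'_def c'_def del: of_nat_power)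
    qed
    show "\<exists>!(\<gamma>, f0). (\<gamma>, f0) \<in> P \<and>
               cohomologous p r \<eta> a b g f (cocycle_alpha p \<eta> \<gamma>) (cocycle_f p r a b f0)"
    proof (rule ex1I[of _ "(\<gamma>', c')"])
      fix x assume x: "case x of (\<gamma>, f0) \<Rightarrow> (\<gamma>, f0) \<in> P \<and>
         cohomologous p r \<eta> a b g f (cocycle_alpha p \<eta> \<gamma>) (cocycle_f p r a b f0)"
      obtain \<gamma>1 c1 where x1: "x = (\<gamma>1, c1)" by fastforce
      with x have P1: "(\<gamma>1, c1) \<in> P"
        and coh1: "cohomologous p r \<eta> a b g f (cocycle_alpha p \<eta> \<gamma>1) (cocycle_f p r a b c1)" by auto
      have "\<gamma>1 = \<gamma>'"
        using cohomologous_rep_unique(1)[OF coh1 coh] P1 in_P unfolding P_iff by (simp add: cong_def)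
      moreover obtain e where "[c1 = c' + e * ?t] (mod ?M)"
        using cohomologous_rep_unique(2)[OF coh1 coh] by blast
      \<comment> \<open>As \<open>p^q\<close> divides both \<open>p^r\<close> and \<open>?t\<close>,
        the change by \<open>e * ?t\<close> is invisible modulo \<open>p^q\<close>.\<close>
      then have "[c1 = c' + e * ?t] (mod int (p ^ q))"
        using cong_dvd_modulus[OF _ iffD2[OF int_dvd_int_iff le_imp_power_dvd[OF q(2)]]] by blast
      then have "[c1 = c'] (mod int (p ^ q))"
        using q(1) by (metis cong_add_lcancel_0 cong_0_iff cong_sym cong_trans dvd_mult)
      then have "c1 = c'"
        using P1 in_P unfolding P_iff by (simp add: cong_def)
      ultimately show "x = (\<gamma>', c')" using x1 by simp
    qed (use in_P coh in simp)
  qed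
qed

end
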